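(* Let $n\ge2$ and $\beta<\alpha\in\omega_1\cup\{\mathbb{N}\}$, where $\beta$ is a countable ordinal. Fix a countable ordinal $\gamma$. 1. If $\omega\cdot\gamma\ge\beta$, then Player 1 has a winning strategy in the rank-$\gamma$ discontinuity game for $\mathsf{RT}^n_{\alpha,\beta}$. 2. If $\omega\cdot\gamma<\beta$, then Player 2 has a winning strategy in the rank-$\gamma$ discontinuity game for $\mathsf{RT}^n_{\alpha,\beta}$.
   Context: **Convention.** The symbol $\mathbb{N}$, as a value of the parameter $\alpha$, counts as larger than every countable ordinal: $\beta<\mathbb{N}$ holds for all $\beta<\omega_1$. $\omega\cdot\gamma$ is ordinal multiplication. **Problems.** $\mathbb{N}^{\mathbb{N}}$ is Baire space; $\sigma\sqsubseteq x$ means $\sigma$ is an initial segment of $x$, and $[\![\sigma]\!]$ is the set of infinite sequences extending the finite string $\sigma$. Identify $(\mathbb{N}\cup\{\#\})^{\mathbb{N}}$ with $\mathbb{N}^{\mathbb{N}}$ via $\#\mapsto0$, $n\mapsto n+1$. A problem $P:\subseteq\mathbb{N}^{\mathbb{N}}\rightrightarrows\mathbb{N}^{\mathbb{N}}$ is a partial multivalued function with instances $\mathrm{dom}(P)$ and solution sets $P(p)$, possibly empty. $P|[A\times B]$ has domain $\mathrm{dom}(P)\cap A$ and $P|[A\times B](x)=P(x)\cap B$. **Rank-$\alpha$ discontinuity game for $P$** (recursive definition, $\alpha$ countable). Step 1: Player 1 plays $p\in\mathrm{dom}(P)$. Step 2: if $P(p)=\emptyset$, Player 1 wins and the game ends;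 otherwise Player 2 plays $q\in P(p)$. Step 3: if $\alpha=0$ (and Player 1 has not already won), Player 2 wins and the game ends; otherwise Player 1 plays a finite $\rho\sqsubseteq q$. Step 4: Player 2 plays a finite $\sigma\sqsubseteq p$. Step 5: Player 1 chooses $\gamma<\alpha$ and the players play the rank-$\gamma$ discontinuity game for $P|[[\![\sigma]\!]\times[\![\rho]\!]]$; its winner wins. **The problems $\mathsf{RT}^n_{\alpha,\beta}$** ($n\ge1$). Fix a bijection $\langle\cdot\rangle:[\mathbb{N}]^n\to\mathbb{N}$, where $[A]^n$ is the set of $n$-element subsets of $A$; a coloring $c:[\mathbb{N}]^n\to\mathbb{N}$ is identified with the sequence $c\in\mathbb{N}^{\mathbb{N}}$, $c(\langle a_0,\dots,a_{n-1}\rangle)=c(a_0,\dots,a_{n-1})$. A set $A\subseteq\mathbb{N}$ is identified with its characteristic sequence, and a finite $0$–$1$ string $\phi$ with $\{i:\phi(i)=1\}$. For each $0<\gamma<\omega_1$ fix an enumeration (surjection, repetitions allowed) $w_\gamma:\mathbb{N}\to\gamma$, computable if $\gamma<\omega$. For a countable ordinal $\alpha$ and $\vec v=v_0\dots v_{k-1}\in\mathbb{N}^{<\mathbb{N}}$, put $s_\alpha(\vec v)=\gamma_0\dots\gamma_{k-1}$ where $\gamma_{-1}=\alpha$ and $\gamma_i=w_{\gamma_{i-1}}(v_i)$; it is undefined if some needed $w_{\gamma_{i-1}}$ has $\gamma_{i-1}=0$. So $s_\alpha(\vec v)$ is a strictly decreasing sequence of ordinals below $\alpha$. *Instances, $\alpha<\omega_1$.*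 Index $i$ adds a new color to $c$ if $c(i)\notin\{c(j):j<i\}$. If $c$ has exactly $k$ colors, first appearing at indices $m_0<\dots<m_{k-1}$, write $c=\theta_0\theta_1\cdots\theta_{k-1}r$ with $\theta_0\cdots\theta_i=c|_{m_i+1}$. For $\vec v=v_0\dots v_{k-1}\in\mathrm{dom}(s_\alpha)$ the sequence $\theta_0\#v_0\theta_1\#v_1\cdots\theta_{k-1}\#v_{k-1}r\in(\mathbb{N}\cup\{\#\})^{\mathbb{N}}$ is a name of $(c,s_\alpha(\vec v))$. The instances of $\mathsf{RT}^n_{\alpha,\beta}$ are all such names, for all colorings $c$ with finitely many (say $k$) colors and all $\vec v\in\mathrm{dom}(s_\alpha)$ of length $k$. *Instances, $\alpha=\mathbb{N}$.* The instances of $\mathsf{RT}^n_{\mathbb{N},\beta}$ are the colorings $c:[\mathbb{N}]^n\to\mathbb{N}$ with finite range. *Solutions, $\beta<\omega_1$.* The solutions to an instance with coloring $c$ are all sequences $\phi_0\#v_0\phi_1\#v_1\cdots\phi_{k-1}\#v_{k-1}q$ such that $\phi_0\phi_1\cdots\phi_{k-1}q$ is (the characteristic sequence of) an infinite set $A\subseteq\mathbb{N}$ with $|c([A]^n)|\le k$, $\vec v=v_0\dots v_{k-1}\in\mathrm{dom}(s_\beta)$, and $|c([\phi_0\cdots\phi_{i-1}]^n)|\le i$ for all $i\le k$. *)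

theory Defs
  imports "HOL-Library.Countable_Set_Type" "HOL-Library.Omega_Words_Fun" "HOL-Library.Ramsey"
begin

section \<open>Countable ordinals\<close>

text \<open>
  The type of all countable ordinals: the cardinal successor of \<open>\<aleph>\<^sub>0\<close> is the initial
  well-order of type \<open>\<omega>\<^sub>1\<close>, and each of its elements stands for the order type of its
  initial segment.
\<close>

typedef omega1 = "Field (cardSuc natLeq)"
  using Field_cardSuc_not_empty[OF natLeq_Card_order] by blast

lemma cardSuc_natLeq_Well_order: "Well_order (cardSuc natLeq)"
  by (rule cardSuc_Well_order[OF natLeq_Card_order])

instantiation omega1 :: wellorder
begin

definition less_eq_omega1 :: "omega1 \<Rightarrow> omega1 \<Rightarrow> bool" where
  "x \<le> y \<longleftrightarrow> (Rep_omega1 x, Rep_omega1 y) \<in> cardSuc natLeq"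

definition less_omega1 :: "omega1 \<Rightarrow> omega1 \<Rightarrow> bool" where
  "x < y \<longleftrightarrow> x \<le> y \<and> x \<noteq> (y :: omega1)"

instance
proof
  let ?r = "cardSuc natLeq"
  interpret wo_rel ?r
    using cardSuc_natLeq_Well_order by (simp add: wo_rel_def)
  fix x y z :: omega1
  have anti: "a \<le> b \<Longrightarrow> b \<le> a \<Longrightarrow> a = b" for a b :: omega1
    using ANTISYM by (metis antisymD less_eq_omega1_def Rep_omega1_inject)
  show "x < y \<longleftrightarrow> x \<le> y \<and> \<not> y \<le> x"
    using anti by (auto simp: less_omega1_def)
  show "x \<le> x"
    using REFL Rep_omega1[of x] by (auto simp: less_eq_omega1_def refl_on_def)
  show "x \<le> y \<Longrightarrow> y \<le> z \<Longrightarrow> x \<le> z"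
    using TRANS by (auto simp: less_eq_omega1_def trans_def)
  show "x \<le> y \<Longrightarrow> y \<le> x \<Longrightarrow> x = y"
    by (rule anti)
  show "x \<le> y \<or> y \<le> x"
    using TOTALS Rep_omega1[of x] Rep_omega1[of y] by (auto simp: less_eq_omega1_def)
  fix P :: "omega1 \<Rightarrow> bool"
  assume step: "\<And>x. (\<And>y. y < x \<Longrightarrow> P y) \<Longrightarrow> P x"
  have "wf {(x, y). x < (y :: omega1)}"
  proof (rule wf_subset[OF wf_inv_image[OF WF, of Rep_omega1]])
    show "{(x, y). x < (y :: omega1)} \<subseteq> inv_image (?r - Id) Rep_omega1"
      by (auto simp: inv_image_def less_omega1_def less_eq_omega1_def Rep_omega1_inject)
  qed
  then show "P x"
    by (rule wf_induct_rule) (use step in auto)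
qed

end

lemma countable_lessThan_omega1:
  includes cardinal_syntax
  shows "countable {..<x :: omega1}"
proof -
  let ?r = "cardSuc natLeq"
  have "|underS ?r (Rep_omega1 x)| <o ?r"
    using card_of_underS[OF cardSuc_Card_order[OF natLeq_Card_order] Rep_omega1] .
  then have "|underS ?r (Rep_omega1 x)| \<le>o natLeq"
    by (simp add: cardSuc_ordLeq_ordLess[OF natLeq_Card_order card_of_Card_order])
  then have "countable (underS ?r (Rep_omega1 x))"
    by (simp add: countable_or_card_of countable_card_of_nat)
       (metis card_of_nat ordIso_symmetric ordLeq_ordIso_trans)
  moreover have "Rep_omega1 ` {..<x} \<subseteq> underS ?r (Rep_omega1 x)"
    by (auto simp: underS_def less_omega1_def less_eq_omega1_def Rep_omega1_inject)
  ultimately have "countable (Rep_omega1 ` {..<x})"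
    by (rule countable_subset[rotated])
  then show ?thesis
    by (rule countable_image_inj_on) (auto simp: inj_on_def Rep_omega1_inject)
qed

lemma uncountable_UNIV_omega1:
  includes cardinal_syntax
  shows "uncountable (UNIV :: omega1 set)"
proof
  let ?r = "cardSuc natLeq"
  assume "countable (UNIV :: omega1 set)"
  then have "countable (range Rep_omega1)"
    by simp
  then have "countable (Field ?r)"
    by (simp add: type_definition.Rep_range[OF type_definition_omega1])
  then have "|Field ?r| \<le>o natLeq"
    unfolding countable_card_of_nat using card_of_nat ordLeq_ordIso_trans by blast
  then have "?r \<le>o natLeq"
    using card_of_Field_ordIso[OF cardSuc_Card_order[OF natLeq_Card_order]]
      ordIso_symmetric ordIso_ordLeq_trans by blast
  then show False
    using cardSuc_greater[OF natLeq_Card_order] not_ordLess_ordLeq by blast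
qed

lemma countable_bounded_omega1:
  fixes A :: "omega1 set"
  assumes "countable A"
  shows "\<exists>b. \<forall>a\<in>A. a < b"
proof (rule ccontr)
  assume "\<not> ?thesis"
  then have "UNIV = (\<Union>a\<in>A. insert a {..<a})"
    by (auto simp: not_less) (metis le_less)
  moreover have "countable (\<Union>a\<in>A. insert a {..<a})"
    using assms countable_lessThan_omega1 by auto
  ultimately show False
    using uncountable_UNIV_omega1 by simp
qed

text \<open>
  Ordinal arithmetic by the usual transfinite recursion on the second argument:
  \<open>a + b\<close> is the supremum of \<open>a\<close> and all successors of \<open>a + d\<close>, and
  \<open>a * b\<close> is the supremum of all \<open>a * d + a\<close>, for \<open>d < b\<close>.
\<close>

function plus_ord :: "omega1 \<Rightarrow> omega1 \<Rightarrow> omega1" where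
  "plus_ord a b = (LEAST c. a \<le> c \<and> (\<forall>d<b. plus_ord a d < c))"
  by auto
termination
  by (relation "inv_image {(x, y). x < y} snd") (auto simp: wf)

declare plus_ord.simps [simp del]

function times_ord :: "omega1 \<Rightarrow> omega1 \<Rightarrow> omega1" where
  "times_ord a b = (LEAST c. \<forall>d<b. plus_ord (times_ord a d) a \<le> c)"
  by auto
termination
  by (relation "inv_image {(x, y). x < y} snd") (auto simp: wf)

declare times_ord.simps [simp del]

instantiation omega1 :: "{zero, plus, times}"
begin

definition zero_omega1 :: omega1 where "0 = (LEAST x :: omega1. True)"
definition plus_omega1 :: "omega1 \<Rightarrow> omega1 \<Rightarrow> omega1" where "a + b = plus_ord a b"
definition times_omega1 :: "omega1 \<Rightarrow> omega1 \<Rightarrow> omega1" where "a * b = times_ord a b"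

instance ..

end

definition succ_ord :: "omega1 \<Rightarrow> omega1" where
  "succ_ord x = (LEAST y. x < y)"

definition fin_ord :: "nat \<Rightarrow> omega1" where
  "fin_ord m = (succ_ord ^^ m) 0"

definition omega :: omega1 where
  "omega = (LEAST x. \<forall>m. fin_ord m < x)"

lemma zero_le_omega1 [simp]: "0 \<le> (x :: omega1)"
  by (simp add: zero_omega1_def Least_le)

lemma less_succ_ord_iff: "x < succ_ord y \<longleftrightarrow> x \<le> y"
proof -
  have "\<exists>b. y < b"
    using countable_bounded_omega1[of "{y}"] by auto
  then have "y < succ_ord y"
    unfolding succ_ord_def by (rule LeastI_ex)
  moreover have "succ_ord y \<le> b" if "y < b" for b
    unfolding succ_ord_def using that by (rule Least_le)
  ultimately show ?thesis
    by (meson leD leI le_less_trans)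
qed

lemma plus_omega1_rec:
  "(a :: omega1) + b \<le> c \<longleftrightarrow> a \<le> c \<and> (\<forall>d<b. a + d < c)"
proof -
  let ?P = "\<lambda>c. a \<le> c \<and> (\<forall>d<b. a + d < c)"
  have eq: "a + b = Least ?P"
    unfolding plus_omega1_def by (rule plus_ord.simps)
  have "countable (insert a ((\<lambda>d. a + d) ` {..<b}))"
    using countable_lessThan_omega1 by simp
  from countable_bounded_omega1[OF this] have "\<exists>c. ?P c"
    by (auto intro: less_imp_le)
  then have "?P (a + b)"
    unfolding eq by (rule LeastI_ex)
  then show ?thesis
    using Least_le[of ?P c] eq by (metis (no_types, lifting) le_less_trans less_le_trans order_trans)
qed

lemma times_omega1_rec:
  "(a :: omega1) * b \<le> c \<longleftrightarrow> (\<forall>d<b. a * d + a \<le> c)"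
proof -
  let ?P = "\<lambda>c. \<forall>d<b. a * d + a \<le> c"
  have eq: "a * b = Least ?P"
    unfolding times_omega1_def plus_omega1_def by (rule times_ord.simps)
  have "countable ((\<lambda>d. a * d + a) ` {..<b})"
    using countable_lessThan_omega1 by simp
  from countable_bounded_omega1[OF this] have "\<exists>c. ?P c"
    by (auto intro: less_imp_le)
  then have "?P (a * b)"
    unfolding eq by (rule LeastI_ex)
  then show ?thesis
    using Least_le[of ?P c] eq by (metis (no_types, lifting) order_trans)
qed

lemma less_omega_iff: "x < omega \<longleftrightarrow> (\<exists>m. x = fin_ord m)"
proof
  have "\<exists>x. \<forall>m. fin_ord m < x"
    using countable_bounded_omega1[of "range fin_ord"] by auto
  then have *: "\<forall>m. fin_ord m < omega"
    unfolding omega_def by (rule LeastI_ex)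
  then show "\<exists>m. x = fin_ord m \<Longrightarrow> x < omega"
    by blast
  assume "x < omega"
  then have "\<exists>m. x \<le> fin_ord m"
    unfolding omega_def using not_less_Least[of x "\<lambda>x. \<forall>m. fin_ord m < x"] not_less by blast
  then obtain m where "x \<le> fin_ord m" ..
  then show "\<exists>m. x = fin_ord m"
  proof (induction m)
    case 0
    then show ?case
      by (metis fin_ord_def funpow_0 order_antisym zero_le_omega1)
  next
    case (Suc m)
    then show ?case
    proof (cases "x = fin_ord (Suc m)")
      case False
      with Suc.prems have "x < succ_ord (fin_ord m)"
        by (simp add: fin_ord_def)
      then show ?thesis
        using Suc.IH by (simp add: less_succ_ord_iff)
    qed blast
  qed
qed

text \<open>The values of the first parameter of Ramsey's theorem, \<open>\<omega>\<^sub>1 \<union> {\<nat>}\<close>, with \<open>\<nat>\<close> on top.\<close>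

datatype bound = Ord omega1 | Naturals

fun ord_less_bound :: "omega1 \<Rightarrow> bound \<Rightarrow> bool" where
  "ord_less_bound b (Ord a) \<longleftrightarrow> b < a"
| "ord_less_bound b Naturals \<longleftrightarrow> True"


section \<open>Computable functions\<close>

datatype recf =
    Zero_rf | Succ_rf | Proj_rf nat | Comp_rf recf "recf list" | Rec_rf recf recf | Mu_rf recf

inductive evaluates :: "recf \<Rightarrow> nat list \<Rightarrow> nat \<Rightarrow> bool" where
  "evaluates Zero_rf xs 0"
| "evaluates Succ_rf [x] (Suc x)"
| "i < length xs \<Longrightarrow> evaluates (Proj_rf i) xs (xs ! i)"
| "length ys = length gs \<Longrightarrow> \<forall>i<length gs. evaluates (gs ! i) xs (ys ! i) \<Longrightarrow>
    evaluates f ys z \<Longrightarrow> evaluates (Comp_rf f gs) xs z"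
| "evaluates f xs z \<Longrightarrow> evaluates (Rec_rf f g) (0 # xs) z"
| "evaluates (Rec_rf f g) (m # xs) y \<Longrightarrow> evaluates g (m # y # xs) z \<Longrightarrow>
    evaluates (Rec_rf f g) (Suc m # xs) z"
| "evaluates f (m # xs) 0 \<Longrightarrow> \<forall>i<m. \<exists>y. evaluates f (i # xs) (Suc y) \<Longrightarrow>
    evaluates (Mu_rf f) xs m"

definition computable :: "(nat \<Rightarrow> nat) \<Rightarrow> bool" where
  "computable f \<longleftrightarrow> (\<exists>e. \<forall>x. evaluates e [x] (f x))"

inductive_cases evaluates_basicE:
  "evaluates Zero_rf xs z" "evaluates Succ_rf xs z" "evaluates (Proj_rf i) xs z"
inductive_cases evaluates_Rec_0E: "evaluates (Rec_rf f g) (0 # xs) z"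
inductive_cases evaluates_Rec_SucE: "evaluates (Rec_rf f g) (Suc m # xs) z"

lemma evaluates_functional: "evaluates e xs y \<Longrightarrow> evaluates e xs z \<Longrightarrow> y = z"
proof (induction arbitrary: z rule: evaluates.induct)
  case (4 ys gs xs f y)
  from 4(5) obtain zs where zs: "length zs = length gs" "evaluates f zs z"
      "\<forall>i<length gs. evaluates (gs ! i) xs (zs ! i)"
    by (auto elim: evaluates.cases)
  with 4 have "ys = zs"
    by (intro nth_equalityI) auto
  with zs 4 show ?case
    by blast
next
  case (7 f m xs)
  from 7(4) have *: "evaluates f (z # xs) 0" "\<forall>i<z. \<exists>y. evaluates f (i # xs) (Suc y)"
    by (auto elim: evaluates.cases)
  show ?case
    using 7 * by (cases m z rule: linorder_cases) fastforce+
next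
  case (5 f xs y g)
  from 5(3) have "evaluates f xs z"
    by (rule evaluates_Rec_0E)
  with 5 show ?case
    by blast
next
  case (6 f g m xs y u)
  from 6(5) obtain y' where "evaluates (Rec_rf f g) (m # xs) y'" "evaluates g (m # y' # xs) z"
    by (rule evaluates_Rec_SucE)
  with 6 show ?case
    by blast
next
  case (1 xs)
  then show ?case
    by (rule evaluates_basicE(1)) simp
next
  case (2 x)
  then show ?case
    by (rule evaluates_basicE(2)) simp
next
  case (3 i xs)
  from 3(2) show ?case
    by (rule evaluates_basicE(3)) simp
qed

lemma computable_min: "computable (\<lambda>x. min x m)"
  unfolding computable_def
proof (induction m)
  case 0
  show ?case
    by (auto intro: evaluates.intros)
next
  case (Suc m)
  then obtain e where e: "\<And>x. evaluates e [x] (min x m)"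
    by blast
  let ?g = "Comp_rf Succ_rf [Comp_rf e [Proj_rf 0]]"
  have g: "evaluates ?g [x, y] (Suc (min x m))" for x y
  proof -
    have "evaluates (Proj_rf 0) [x, y] x"
      using evaluates.intros(3)[of 0 "[x, y]"] by simp
    then have "evaluates (Comp_rf e [Proj_rf 0]) [x, y] (min x m)"
      by (intro evaluates.intros(4)[OF _ _ e]) auto
    then show ?thesis
      by (intro evaluates.intros(4)[OF _ _ evaluates.intros(2)]) auto
  qed
  have "evaluates (Rec_rf Zero_rf ?g) [x] (min x (Suc m))" for x
  proof (induction x)
    case 0
    show ?case
      by (auto intro: evaluates.intros)
  next
    case (Suc x)
    show ?case
      using evaluates.intros(6)[OF Suc g] by simp
  qed
  then show ?case
    by blast
qed


section \<open>Problems and the discontinuity game\<close>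

text \<open>
  A problem maps each instance to its set of solutions (possibly empty) and everything
  outside its domain to \<open>None\<close>.
\<close>

type_synonym problem = "nat word \<Rightarrow> nat word set option"

definition initial_segment :: "'a list \<Rightarrow> 'a word \<Rightarrow> bool" (infix "\<sqsubseteq>" 50) where
  "\<sigma> \<sqsubseteq> x \<longleftrightarrow> (\<exists>y. x = \<sigma> \<frown> y)"

definition cylinder :: "'a list \<Rightarrow> 'a word set" where
  "cylinder \<sigma> = {x. \<sigma> \<sqsubseteq> x}"

definition restrict_problem :: "problem \<Rightarrow> nat word set \<Rightarrow> nat word set \<Rightarrow> problem" where
  "restrict_problem P A B = (\<lambda>x. map_option (\<lambda>S. S \<inter> B) (P x)) |` A"

datatype player = Player1 | Player2

datatype move = Sequence "nat word" | Segment "nat list" | Rank omega1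

text \<open>
  A position of the game consists of the current problem and rank, together with the moves
  made so far in the current round; \<open>Stage\<close>\<open>i\<close> is the position at which step \<open>i\<close> is
  carried out.
\<close>

datatype position =
    Stage1 problem omega1
  | Stage2 problem omega1 "nat word"
  | Stage3 problem omega1 "nat word" "nat word"
  | Stage4 problem omega1 "nat word" "nat word" "nat list"
  | Stage5 problem omega1 "nat word" "nat word" "nat list" "nat list"
  | Won player

inductive legal_move :: "position \<Rightarrow> move \<Rightarrow> position \<Rightarrow> bool" where
  "p \<in> dom P \<Longrightarrow>
    legal_move (Stage1 P \<alpha>) (Sequence p) (if P p = Some {} then Won Player1 else Stage2 P \<alpha> p)"
| "q \<in> the (P p) \<Longrightarrow>
    legal_move (Stage2 P \<alpha> p) (Sequence q) (if \<alpha> = 0 then Won Player2 else Stage3 P \<alpha> p q)"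
| "\<rho> \<sqsubseteq> q \<Longrightarrow> legal_move (Stage3 P \<alpha> p q) (Segment \<rho>) (Stage4 P \<alpha> p q \<rho>)"
| "\<sigma> \<sqsubseteq> p \<Longrightarrow> legal_move (Stage4 P \<alpha> p q \<rho>) (Segment \<sigma>) (Stage5 P \<alpha> p q \<rho> \<sigma>)"
| "\<gamma> < \<alpha> \<Longrightarrow> legal_move (Stage5 P \<alpha> p q \<rho> \<sigma>) (Rank \<gamma>)
    (Stage1 (restrict_problem P (cylinder \<sigma>) (cylinder \<rho>)) \<gamma>)"

fun to_move :: "position \<Rightarrow> player option" where
  "to_move (Stage1 P \<alpha>) = Some Player1"
| "to_move (Stage2 P \<alpha> p) = Some Player2"
| "to_move (Stage3 P \<alpha> p q) = Some Player1"
| "to_move (Stage4 P \<alpha> p q \<rho>) = Some Player2"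
| "to_move (Stage5 P \<alpha> p q \<rho> \<sigma>) = Some Player1"
| "to_move (Won i) = None"

text \<open>A strategy chooses a move depending on the list of all moves made so far, oldest first.\<close>

type_synonym strategy = "move list \<Rightarrow> move"

text \<open>
  \<open>play i s x h y\<close>: the moves \<open>h\<close> lead from \<open>x\<close> to \<open>y\<close>, and player \<open>i\<close> has followed \<open>s\<close>.
\<close>

inductive play :: "player \<Rightarrow> strategy \<Rightarrow> position \<Rightarrow> move list \<Rightarrow> position \<Rightarrow> bool"
  for i s x where
  "play i s x [] x"
| "play i s x h y \<Longrightarrow> legal_move y m z \<Longrightarrow> (to_move y = Some i \<longrightarrow> m = s h) \<Longrightarrow>
    play i s x (h @ [m]) z"

text \<open>
  A winning strategy always prescribes a legal move, and every completed play following it is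
  won. There are no infinite plays, see \<open>wf_legal_move\<close> below.
\<close>

definition winning_strategy :: "player \<Rightarrow> strategy \<Rightarrow> position \<Rightarrow> bool" where
  "winning_strategy i s x \<longleftrightarrow>
    (\<forall>h y. play i s x h y \<longrightarrow>
      (to_move y = Some i \<longrightarrow> (\<exists>z. legal_move y (s h) z)) \<and>
      (\<forall>j. y = Won j \<longrightarrow> j = i))"

definition has_winning_strategy :: "player \<Rightarrow> position \<Rightarrow> bool" where
  "has_winning_strategy i x \<longleftrightarrow> (\<exists>s. winning_strategy i s x)"

definition discontinuity_game :: "omega1 \<Rightarrow> problem \<Rightarrow> position" where
  "discontinuity_game \<alpha> P = Stage1 P \<alpha>"

fun rank_and_stage :: "position \<Rightarrow> omega1 \<times> nat" where
  "rank_and_stage (Stage1 P \<alpha>) = (\<alpha>, 5)"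
| "rank_and_stage (Stage2 P \<alpha> p) = (\<alpha>, 4)"
| "rank_and_stage (Stage3 P \<alpha> p q) = (\<alpha>, 3)"
| "rank_and_stage (Stage4 P \<alpha> p q \<rho>) = (\<alpha>, 2)"
| "rank_and_stage (Stage5 P \<alpha> p q \<rho> \<sigma>) = (\<alpha>, 1)"
| "rank_and_stage (Won i) = (0, 0)"

lemma wf_legal_move: "wf {(y, x). \<exists>m. legal_move x m y}"
proof (rule wf_subset)
  show "wf (inv_image ({(a, b). a < b} <*lex*> less_than) rank_and_stage)"
    by (intro wf_inv_image wf_lex_prod wf wf_less_than)
  have "0 = \<alpha> \<or> 0 < \<alpha>" for \<alpha> :: omega1
    using zero_le_omega1[of \<alpha>] by (simp only: le_less disj_commute)
  then show "{(y, x). \<exists>m. legal_move x m y} \<subseteq>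
      inv_image ({(a, b). a < b} <*lex*> less_than) rank_and_stage"
    by (fastforce elim: legal_move.cases)
qed


section \<open>Ramsey's theorem with mind changes\<close>

text \<open>
  The letter \<open>#\<close> is \<open>None\<close>. The word \<open>marked [(\<theta>\<^sub>0, v\<^sub>0), \<dots>] r\<close> is
  \<open>\<theta>\<^sub>0 # v\<^sub>0 \<theta>\<^sub>1 # v\<^sub>1 \<dots> r\<close>, and \<open>encode\<close> identifies it with an
  element of Baire space.
\<close>

fun marked :: "(nat list \<times> nat) list \<Rightarrow> nat word \<Rightarrow> nat option word" where
  "marked [] r = Some \<circ> r"
| "marked ((\<theta>, v) # bs) r = (map Some \<theta> @ [None, Some v]) \<frown> marked bs r"

definition encode :: "(nat list \<times> nat) list \<Rightarrow> nat word \<Rightarrow> nat word" where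
  "encode bs r = case_option 0 Suc \<circ> marked bs r"

definition is_enumeration :: "(omega1 \<Rightarrow> nat \<Rightarrow> omega1) \<Rightarrow> bool" where
  "is_enumeration w \<longleftrightarrow>
    (\<forall>\<gamma>>0. range (w \<gamma>) = {..<\<gamma>}) \<and>
    (\<forall>\<gamma>>0. \<gamma> < omega \<longrightarrow> (\<exists>f. computable f \<and> w \<gamma> = fin_ord \<circ> f))"

lemma lessThan_fin_ord: "{..<fin_ord m} = fin_ord ` {..<m}"
proof (induction m)
  case 0
  have "\<not> x < (0 :: omega1)" for x
    by (rule leD) simp
  then show ?case
    by (auto simp: fin_ord_def)
next
  case (Suc m)
  have "{..<fin_ord (Suc m)} = {..fin_ord m}"
    by (simp add: fin_ord_def less_succ_ord_iff set_eq_iff)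
  also have "\<dots> = insert (fin_ord m) {..<fin_ord m}"
    by (auto simp: le_less)
  finally show ?case
    by (simp only: Suc lessThan_Suc image_insert)
qed

lemma range_min: "range (\<lambda>x. min x k) = {..<Suc k}"
proof
  show "{..<Suc k} \<subseteq> range (\<lambda>x. min x k)"
  proof
    fix x
    assume "x \<in> {..<Suc k}"
    then have "x = min x k"
      by simp
    then show "x \<in> range (\<lambda>x. min x k)"
      by (rule range_eqI)
  qed
qed auto

lemma ex_computable_fin_ord:
  assumes "0 < \<gamma>" "\<gamma> < omega"
  shows "\<exists>f. computable f \<and> range (fin_ord \<circ> f) = {..<\<gamma>}"
proof -
  obtain m where m: "\<gamma> = fin_ord m"
    using assms(2) less_omega_iff by blast
  have "m \<noteq> 0"
    using assms(1) by (rule contrapos_pn) (simp add: m fin_ord_def)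
  then obtain k where "m = Suc k"
    by (rule not0_implies_Suc[THEN exE])
  then have "fin_ord ` range (\<lambda>x. min x k) = {..<\<gamma>}"
    by (simp only: m range_min lessThan_fin_ord)
  then show ?thesis
    using computable_min[of k] by (metis image_comp)
qed

lemma ex_is_enumeration: "\<exists>w. is_enumeration w"
proof -
  have "\<exists>u. \<gamma> > 0 \<longrightarrow> range u = {..<\<gamma>} \<and>
      (\<gamma> < omega \<longrightarrow> (\<exists>f. computable f \<and> u = fin_ord \<circ> f))" for \<gamma>
  proof (cases "0 < \<gamma> \<and> \<gamma> < omega")
    case True
    then show ?thesis
      using ex_computable_fin_ord by blast
  next
    case False
    have "range (from_nat_into {..<\<gamma>}) = {..<\<gamma>}" if "0 < \<gamma>"
      using that by (intro range_from_nat_into countable_lessThan_omega1) blast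
    with False show ?thesis
      by blast
  qed
  then obtain w where "\<forall>\<gamma>. \<gamma> > 0 \<longrightarrow> range (w \<gamma>) = {..<\<gamma>} \<and>
      (\<gamma> < omega \<longrightarrow> (\<exists>f. computable f \<and> w \<gamma> = fin_ord \<circ> f))"
    using choice[of "\<lambda>\<gamma> u. \<gamma> > 0 \<longrightarrow> range u = {..<\<gamma>} \<and>
      (\<gamma> < omega \<longrightarrow> (\<exists>f. computable f \<and> u = fin_ord \<circ> f))"] by blast
  then have "is_enumeration w"
    by (simp add: is_enumeration_def)
  then show ?thesis
    by (rule exI[of is_enumeration])
qed

fun descent :: "(omega1 \<Rightarrow> nat \<Rightarrow> omega1) \<Rightarrow> omega1 \<Rightarrow> nat list \<Rightarrow> omega1 list option" where
  "descent w \<alpha> [] = Some []"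
| "descent w \<alpha> (v # vs) =
    (if \<alpha> = 0 then None else map_option ((#) (w \<alpha> v)) (descent w (w \<alpha> v) vs))"

text \<open>
  A coloring of \<open>[\<nat>]\<^sup>n\<close> is a sequence \<open>c\<close>, the color of an \<open>n\<close>-element set \<open>X\<close> being
  \<open>c (code X)\<close>.
\<close>

definition colors_on :: "(nat set \<Rightarrow> nat) \<Rightarrow> nat \<Rightarrow> nat word \<Rightarrow> nat set \<Rightarrow> nat set" where
  "colors_on code n c A = (\<lambda>X. c (code X)) ` [A]\<^bsup>n\<^esup>"

definition new_color_indices :: "nat word \<Rightarrow> nat list" where
  "new_color_indices c = sorted_list_of_set {i. c i \<notin> c ` {..<i}}"

definition is_name :: "(omega1 \<Rightarrow> nat \<Rightarrow> omega1) \<Rightarrow> omega1 \<Rightarrow> nat word \<Rightarrow> nat word \<Rightarrow> bool" where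
  "is_name w \<alpha> c p \<longleftrightarrow> finite (range c) \<and>
    (\<exists>bs r. length bs = card (range c) \<and>
      c = concat (map fst bs) \<frown> r \<and>
      (\<forall>i<length bs. concat (map fst (take (Suc i) bs)) = prefix (new_color_indices c ! i + 1) c) \<and>
      map snd bs \<in> dom (descent w \<alpha>) \<and>
      p = encode bs r)"

fun is_instance :: "(omega1 \<Rightarrow> nat \<Rightarrow> omega1) \<Rightarrow> bound \<Rightarrow> nat word \<Rightarrow> nat word \<Rightarrow> bool" where
  "is_instance w (Ord \<alpha>) c p \<longleftrightarrow> is_name w \<alpha> c p"
| "is_instance w Naturals c p \<longleftrightarrow> finite (range c) \<and> p = c"

definition support :: "nat list \<Rightarrow> nat set" where
  "support \<phi> = {i. i < length \<phi> \<and> \<phi> ! i = 1}"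

definition is_solution ::
    "(nat set \<Rightarrow> nat) \<Rightarrow> (omega1 \<Rightarrow> nat \<Rightarrow> omega1) \<Rightarrow> nat \<Rightarrow> omega1 \<Rightarrow> nat word \<Rightarrow> nat word \<Rightarrow> bool" where
  "is_solution code w n \<beta> c x \<longleftrightarrow>
    (\<exists>bs q A. x = encode bs q \<and>
      concat (map fst bs) \<frown> q = (\<lambda>i. of_bool (i \<in> A)) \<and> infinite A \<and>
      card (colors_on code n c A) \<le> length bs \<and>
      map snd bs \<in> dom (descent w \<beta>) \<and>
      (\<forall>i\<le>length bs. card (colors_on code n c (support (concat (map fst (take i bs))))) \<le> i))"

text \<open>The coloring of an instance is unique, see \<open>is_instance_unique\<close> below.\<close>

definition RT ::
    "(nat set \<Rightarrow> nat) \<Rightarrow> (omega1 \<Rightarrow> nat \<Rightarrow> omega1) \<Rightarrow> nat \<Rightarrow> bound \<Rightarrow> omega1 \<Rightarrow> problem" where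
  "RT code w n \<alpha> \<beta> p =
    (if \<exists>c. is_instance w \<alpha> c p
     then Some {x. \<exists>c. is_instance w \<alpha> c p \<and> is_solution code w n \<beta> c x}
     else None)"

lemma marked_block_inject:
  assumes "(map Some \<theta> @ [None, Some v]) \<frown> x = (map Some \<theta>' @ [None, Some v']) \<frown> x'"
  shows "\<theta> = \<theta>' \<and> v = v' \<and> x = x'"
proof -
  let ?u = "map Some \<theta> @ [None, Some v]" and ?u' = "map Some \<theta>' @ [None, Some v']"
  have at: "(?u \<frown> x) i = (?u' \<frown> x') i" for i
    using assms by simp
  have "length \<theta> = length \<theta>'"
    using at[of "length \<theta>"] at[of "length \<theta>'"]
    by (cases "length \<theta>" "length \<theta>'" rule: linorder_cases) (auto simp: conc_def nth_append)
  then have "length ?u = length ?u'"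
    by simp
  moreover have "?u ! i = ?u' ! i" if "i < length ?u" for i
    using at[of i] that \<open>length ?u = length ?u'\<close> by (simp only: conc_fst)
  ultimately have "?u = ?u'"
    by (rule nth_equalityI)
  moreover have "x i = x' i" for i
    using at[of "length ?u + i"] \<open>length ?u = length ?u'\<close> by (simp add: conc_def)
  ultimately show ?thesis
    by (auto simp: map_injective)
qed

lemma encode_inject: "encode bs r = encode bs' r' \<longleftrightarrow> bs = bs' \<and> r = r'"
proof -
  have "bs = bs' \<and> r = r'" if "marked bs r = marked bs' r'"
    using that
  proof (induction bs arbitrary: bs')
    case Nil
    show ?case
    proof (cases bs')
      case Nil
      with Nil.prems show ?thesis
        by (auto simp: fun_eq_iff)
    next
      case (Cons b bs'')
      obtain \<theta> v where "b = (\<theta>, v)"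
        by fastforce
      with Cons have "marked bs' r' (length \<theta>) = None"
        by (simp add: conc_def nth_append)
      with Nil.prems have "(Some \<circ> r) (length \<theta>) = None"
        by (metis marked.simps(1))
      then show ?thesis
        by simp
    qed
  next
    case (Cons b bs)
    obtain \<theta> v where b: "b = (\<theta>, v)"
      by fastforce
    show ?case
    proof (cases bs')
      case Nil
      have "marked (b # bs) r (length \<theta>) = None"
        using b by (simp add: conc_def nth_append)
      with Nil Cons.prems have "(Some \<circ> r') (length \<theta>) = None"
        by (metis marked.simps(1))
      then show ?thesis
        by simp
    next
      case (Cons b' bs'')
      obtain \<theta>' v' where b': "b' = (\<theta>', v')"
        by fastforce
      show ?thesis
        using marked_block_inject[of \<theta> v "marked bs r" \<theta>' v' "marked bs'' r'"]
          Cons.prems Cons.IH[of bs''] b b' Cons by auto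
    qed
  qed
  moreover have "marked bs r = marked bs' r'" if "encode bs r = encode bs' r'"
  proof
    fix i
    show "marked bs r i = marked bs' r' i"
      using fun_cong[OF that, of i] by (auto simp: encode_def split: option.splits)
  qed
  ultimately show ?thesis
    by blast
qed

lemma is_instance_unique:
  "is_instance w \<alpha> c p \<Longrightarrow> is_instance w \<alpha> d p \<Longrightarrow> c = d"
  by (cases \<alpha>) (auto simp: is_name_def encode_inject)

end

theory Submission
  imports Defs
begin

text \<open>
  Both players are measured by what remains of their ordinals. A mark in a solution lowers the
  second player's ordinal, which starts at \<open>\<beta>\<close>; a new color in an instance lowers the first
  player's, which starts above \<open>\<beta>\<close> or is not bounded at all. A set with \<open>k\<close> colors needs \<open>k\<close>
  marks, so the question is how many marks the first player can force. In a round of rank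
  \<open>\<gamma>\<close> the critical value is \<open>\<omega> \<cdot> \<gamma>\<close>: the first player tries to keep the second one strictly below
  it, the second player tries to stay at or above it.

  The first player wins if \<open>\<beta> \<le> \<omega> \<cdot> \<gamma>\<close> (\<open>Player1_wins\<close>). Suppose the second player has answered
  with \<open>j\<close> marks and an ordinal \<open>b < \<omega> \<cdot> \<gamma>\<close>. Then \<open>b = \<omega> \<cdot> \<delta> + m\<close> for some \<open>\<delta> < \<gamma>\<close> and
  finite \<open>m\<close>. The first player's segment fixes all marks and a set \<open>F\<close> of at least \<open>m + j + 1\<close>
  elements of the answer, with no fewer elements than there are colors so far. However long a part
  of the instance the second player then fixes, the first player recolors, outside that part, the
  \<open>n\<close>-sets whose least element is in \<open>F\<close>, with one color per element of \<open>F\<close>. Since \<open>n \<ge> 2\<close>,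
  any infinite \<open>A \<supseteq> F\<close> has, for each \<open>f \<in> F\<close>, infinitely many \<open>n\<close>-subsets with least element \<open>f\<close>, so
  every solution that is still possible sees all these colors (\<open>recoloring\<close>). It therefore has more
  than \<open>m\<close> additional marks, and these take \<open>b\<close> below \<open>\<omega> \<cdot> \<delta>\<close>: the same situation at the smaller
  rank \<open>\<delta>\<close>. The first player can pay for the new colors and keep \<open>\<omega> \<cdot> \<delta>\<close>, having at least \<open>\<beta>\<close>
  left after the first color and so being ahead of the second player. At rank \<open>0\<close> the situation is
  contradictory, hence there is no answer and the first player has won.

  The second player wins if \<open>\<omega> \<cdot> \<gamma> < \<beta>\<close> (\<open>Player2_wins\<close>). The first answer is a homogeneous set,
  given by Ramsey's theorem, with a single mark of ordinal \<open>\<omega> \<cdot> \<gamma>\<close> (\<open>ex_good_first_reply\<close>).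
  Once the first player has fixed a part of the answer, the second player fixes so much of the
  instance that the colors of that finite part can no longer change (\<open>good_reply_imp_safe\<close>). At the
  next rank \<open>\<delta> < \<gamma>\<close> there is room for any finite number of marks above \<open>\<omega> \<cdot> \<delta>\<close>. So the second player
  spends, at once, as many marks as the new instance has colors; after that every infinite
  extension of the finite part is a solution (\<open>safe_imp_good_reply\<close>).
\<close>

section \<open>Winning positions\<close>

text \<open>
  Backward induction. All plays are finite, so the least fixed point suffices, and it replaces
  strategies, which depend on the history, by a recursion on positions.
\<close>

inductive wins :: "player \<Rightarrow> position \<Rightarrow> bool" for i where
  wins_Won: "wins i (Won i)"
| wins_own: "to_move x = Some i \<Longrightarrow> legal_move x m y \<Longrightarrow> wins i y \<Longrightarrow> wins i x"
| wins_other: "to_move x = Some j \<Longrightarrow> j \<noteq> i \<Longrightarrow> (\<And>m y. legal_move x m y \<Longrightarrow> wins i y) \<Longrightarrow> wins i x"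

inductive_cases legal_move_Stage:
  "legal_move (Stage1 P \<alpha>) m y" "legal_move (Stage2 P \<alpha> p) m y"
  "legal_move (Stage3 P \<alpha> p q) m y" "legal_move (Stage4 P \<alpha> p q \<rho>) m y"
  "legal_move (Stage5 P \<alpha> p q \<rho> \<sigma>) m y" "legal_move (Won i) m y"

lemma legal_move_deterministic: "legal_move x m y \<Longrightarrow> legal_move x m z \<Longrightarrow> y = z"
  by (cases x) (auto elim!: legal_move_Stage)

lemma wins_WonD: "wins i (Won j) \<Longrightarrow> j = i"
  by (cases rule: wins.cases) auto

lemma wins_otherD:
  assumes "wins i x" "to_move x \<noteq> Some i" "legal_move x m y"
  shows "wins i y"
  using assms(1)
proof cases
  case wins_Won
  then show ?thesis
    using assms(3) by (auto elim: legal_move_Stage)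
qed (use assms in auto)

text \<open>
  The strategy recomputes the current position from the history and picks a move to a winning
  position; moves determine their result, so the recomputed position is the actual one.
\<close>

lemma wins_imp_has_winning_strategy:
  assumes "wins i x"
  shows "has_winning_strategy i x"
proof -
  define pos where "pos h = foldl (\<lambda>y m. THE z. legal_move y m z) x h" for h
  define s where "s h = (SOME m. \<exists>z. legal_move (pos h) m z \<and> wins i z)" for h
  have pos_snoc: "pos (h @ [m]) = z" if "pos h = y" "legal_move y m z" for h m y z
  proof -
    have "(THE z. legal_move y m z) = z"
      using that(2) by (blast intro: legal_move_deterministic)
    then show ?thesis
      using that(1) by (simp add: pos_def)
  qed
  have good: "\<exists>z. legal_move y (s h) z \<and> wins i z"
    if "wins i y" "to_move y = Some i" "pos h = y" for h y
  proof -
    from that(1,2) have "\<exists>m z. legal_move y m z \<and> wins i z"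
      by cases auto
    then show ?thesis
      using that(3) someI_ex[of "\<lambda>m. \<exists>z. legal_move y m z \<and> wins i z"] by (simp add: s_def)
  qed
  have reach: "wins i y \<and> pos h = y" if "play i s x h y" for h y
    using that
  proof induction
    case 1
    then show ?case
      using assms by (simp add: pos_def)
  next
    case (2 h y m z)
    have "wins i z"
    proof (cases "to_move y = Some i")
      case True
      then show ?thesis
        using 2 good legal_move_deterministic by blast
    next
      case False
      then show ?thesis
        using 2 wins_otherD by blast
    qed
    then show ?case
      using 2 pos_snoc by blast
  qed
  have "winning_strategy i s x"
    unfolding winning_strategy_def using reach good wins_WonD by blast
  then show ?thesis
    unfolding has_winning_strategy_def by blast
qed

text \<open>
  One full round: what remains is a game of smaller rank for a restricted problem. An instance with
  an empty set \<open>S\<close> of solutions wins at once, and satisfies the second assumption vacuously.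
\<close>

lemma wins_Player1I:
  assumes "P p = Some S"
    and "\<And>q. q \<in> S \<Longrightarrow> \<exists>\<rho>. \<rho> \<sqsubseteq> q \<and> (\<forall>\<sigma>. \<sigma> \<sqsubseteq> p \<longrightarrow> (\<exists>\<delta><\<gamma>.
      wins Player1 (Stage1 (restrict_problem P (cylinder \<sigma>) (cylinder \<rho>)) \<delta>)))"
  shows "wins Player1 (Stage1 P \<gamma>)"
proof -
  have 2: "wins Player1 (Stage2 P \<gamma> p)"
  proof (rule wins_other)
    fix m y
    assume "legal_move (Stage2 P \<gamma> p) m y"
    then obtain q where q: "q \<in> S" and y: "y = (if \<gamma> = 0 then Won Player2 else Stage3 P \<gamma> p q)"
      using assms(1) by (auto elim: legal_move_Stage)
    from assms(2)[OF q] obtain \<rho> where \<rho>: "\<rho> \<sqsubseteq> q" and win: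
        "\<forall>\<sigma>. \<sigma> \<sqsubseteq> p \<longrightarrow> (\<exists>\<delta><\<gamma>.
          wins Player1 (Stage1 (restrict_problem P (cylinder \<sigma>) (cylinder \<rho>)) \<delta>))"
      by blast
    \<comment> \<open>The empty segment is a legal reply, so some smaller rank exists.\<close>
    have "[] \<sqsubseteq> p"
      by (auto simp: initial_segment_def)
    with win have "\<gamma> \<noteq> 0"
      using leD zero_le_omega1 by blast
    moreover have "wins Player1 (Stage3 P \<gamma> p q)"
    proof (rule wins_own[OF _ legal_move.intros(3)[OF \<rho>]])
      show "wins Player1 (Stage4 P \<gamma> p q \<rho>)"
      proof (rule wins_other)
        fix m y
        assume "legal_move (Stage4 P \<gamma> p q \<rho>) m y"
        then obtain \<sigma> where "\<sigma> \<sqsubseteq> p" "y = Stage5 P \<gamma> p q \<rho> \<sigma>"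
          by (auto elim: legal_move_Stage)
        with win obtain \<delta> where "\<delta> < \<gamma>"
            "wins Player1 (Stage1 (restrict_problem P (cylinder \<sigma>) (cylinder \<rho>)) \<delta>)"
          by blast
        then show "wins Player1 y"
          unfolding \<open>y = _\<close> by (intro wins_own[OF _ legal_move.intros(5)]) auto
      qed auto
    qed simp
    ultimately show "wins Player1 y"
      using y by simp
  qed auto
  show ?thesis
  proof (rule wins_own[OF _ legal_move.intros(1)])
    show "wins Player1 (if P p = Some {} then Won Player1 else Stage2 P \<gamma> p)"
      using 2 by (auto intro: wins_Won)
  qed (use assms(1) in auto)
qed

lemma wins_Player2I:
  assumes "\<And>p S. P p = Some S \<Longrightarrow> \<exists>q\<in>S. \<forall>\<rho>. \<rho> \<sqsubseteq> q \<longrightarrow> (\<exists>\<sigma>. \<sigma> \<sqsubseteq> p \<and> (\<forall>\<delta><\<gamma>.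
      wins Player2 (Stage1 (restrict_problem P (cylinder \<sigma>) (cylinder \<rho>)) \<delta>)))"
  shows "wins Player2 (Stage1 P \<gamma>)"
proof (rule wins_other)
  fix m y
  assume "legal_move (Stage1 P \<gamma>) m y"
  then obtain p S where p: "P p = Some S"
      and y: "y = (if P p = Some {} then Won Player1 else Stage2 P \<gamma> p)"
    by (auto elim: legal_move_Stage)
  from assms[OF p] obtain q where q: "q \<in> S" and win:
      "\<forall>\<rho>. \<rho> \<sqsubseteq> q \<longrightarrow> (\<exists>\<sigma>. \<sigma> \<sqsubseteq> p \<and> (\<forall>\<delta><\<gamma>.
        wins Player2 (Stage1 (restrict_problem P (cylinder \<sigma>) (cylinder \<rho>)) \<delta>)))"
    by blast
  have "wins Player2 (Stage3 P \<gamma> p q)"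
  proof (rule wins_other)
    fix m y
    assume "legal_move (Stage3 P \<gamma> p q) m y"
    then obtain \<rho> where "\<rho> \<sqsubseteq> q" and y: "y = Stage4 P \<gamma> p q \<rho>"
      by (auto elim: legal_move_Stage)
    with win obtain \<sigma> where \<sigma>: "\<sigma> \<sqsubseteq> p" and win':
        "\<forall>\<delta><\<gamma>. wins Player2 (Stage1 (restrict_problem P (cylinder \<sigma>) (cylinder \<rho>)) \<delta>)"
      by blast
    have "wins Player2 (Stage5 P \<gamma> p q \<rho> \<sigma>)"
      using win' by - (rule wins_other[where j = Player1], auto elim: legal_move_Stage)
    then show "wins Player2 y"
      unfolding y by (intro wins_own[OF _ legal_move.intros(4)[OF \<sigma>]]) auto
  qed auto
  then have "wins Player2 (Stage2 P \<gamma> p)"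
    by (intro wins_own[OF _ legal_move.intros(2)]) (use q p in \<open>auto intro: wins_Won\<close>)
  then show "wins Player2 y"
    using y p q by auto
qed auto

lemma restrict_problem_eq:
  "restrict_problem P A B p = (if p \<in> A then map_option (\<lambda>S. S \<inter> B) (P p) else None)"
  by (simp add: restrict_problem_def)

lemma restrict_problem_restrict_problem:
  "restrict_problem (restrict_problem P A B) A' B' = restrict_problem P (A \<inter> A') (B \<inter> B')"
  by (rule ext) (auto simp: restrict_problem_def restrict_map_def option.map_comp comp_def Int_assoc)

lemma restrict_problem_UNIV: "restrict_problem P UNIV UNIV = P"
  by (rule ext) (auto simp: restrict_problem_def restrict_map_def option.map_ident)


section \<open>Ordinal arithmetic\<close>

lemma succ_ord_le_iff: "succ_ord x \<le> y \<longleftrightarrow> x < y"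
  using less_succ_ord_iff[of y x] by (auto simp: not_le[symmetric])

lemma zero_less_omega1_iff: "0 < (a :: omega1) \<longleftrightarrow> a \<noteq> 0"
  using zero_le_omega1[of a] by (auto simp: less_le)

lemma funpow_succ_ord_mono: "x \<le> y \<Longrightarrow> (succ_ord ^^ m) x \<le> (succ_ord ^^ m) y"
  by (induction m) (auto simp: succ_ord_le_iff less_succ_ord_iff)

lemma funpow_succ_ord_le: "m \<le> k \<Longrightarrow> (succ_ord ^^ m) x \<le> (succ_ord ^^ k) x"
proof (induction k)
  case (Suc k)
  have "(succ_ord ^^ k) x < succ_ord ((succ_ord ^^ k) x)"
    by (simp add: less_succ_ord_iff)
  then show ?case
    using Suc by (cases "m = Suc k") (auto intro: order_trans less_imp_le)
qed simp

lemma plus_fin_ord: "x + fin_ord m = (succ_ord ^^ m) x"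
proof (induction m)
  case 0
  have "x + fin_ord 0 \<le> x"
    by (subst plus_omega1_rec) (auto simp: fin_ord_def leD)
  moreover have "x \<le> x + fin_ord 0"
    using plus_omega1_rec[of x "fin_ord 0" "x + fin_ord 0"] by simp
  ultimately show ?case
    by simp
next
  case (Suc m)
  have less: "d < fin_ord (Suc m) \<longleftrightarrow> d \<le> fin_ord m" for d
    by (simp add: fin_ord_def less_succ_ord_iff)
  have mono: "x + d \<le> x + fin_ord m" if "d \<le> fin_ord m" for d
    using that plus_omega1_rec[of x "fin_ord m" "x + fin_ord m"] by (auto simp: le_less)
  have "x \<le> x + fin_ord m"
    using plus_omega1_rec[of x "fin_ord m" "x + fin_ord m"] by simp
  then have "x + fin_ord (Suc m) \<le> c \<longleftrightarrow> x + fin_ord m < c" for c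
    unfolding plus_omega1_rec[of x "fin_ord (Suc m)"] less
    using mono by (meson le_less_trans less_imp_le order_refl)
  then have "x + fin_ord (Suc m) = succ_ord (x + fin_ord m)"
    by (metis order_antisym order_refl succ_ord_le_iff)
  then show ?case
    by (simp add: Suc)
qed

text \<open>
  Because \<open>\<omega> \<cdot> \<gamma> \<ge> \<omega> \<cdot> \<delta> + \<omega>\<close>, there is room for any finite number of steps between the critical
  values of two ranks.
\<close>

lemma omega_mult_less:
  assumes "\<delta> < \<gamma>"
  shows "(succ_ord ^^ m) (omega * \<delta>) < omega * \<gamma>"
proof -
  have "omega * \<delta> + omega \<le> omega * \<gamma>"
    using times_omega1_rec[of omega \<gamma> "omega * \<gamma>"] assms by auto
  then have "omega * \<delta> + fin_ord m < omega * \<gamma>"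
    unfolding plus_omega1_rec[of _ omega] using less_omega_iff by blast
  then show ?thesis
    by (simp add: plus_fin_ord)
qed

text \<open>
  Division with remainder by \<open>\<omega>\<close>. The quotient \<open>\<delta>\<close> is the rank the first player moves to, and
  the remainder \<open>m\<close> says how many marks the second player can still afford there.
\<close>

lemma less_omega_multE:
  assumes "b < omega * \<gamma>"
  obtains \<delta> m where "\<delta> < \<gamma>" "b = (succ_ord ^^ m) (omega * \<delta>)"
proof -
  let ?Q = "\<lambda>\<delta>. b < omega * \<delta> + omega"
  \<comment> \<open>Minimality of the quotient gives the lower bound, hence a finite remainder.\<close>
  define \<delta> where "\<delta> = (LEAST \<delta>. ?Q \<delta>)"
  obtain \<epsilon> where \<epsilon>: "\<epsilon> < \<gamma>" "?Q \<epsilon>"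
    using assms times_omega1_rec[of omega \<gamma> b] by (auto simp: not_le[symmetric])
  then have Q: "?Q \<delta>" and "\<delta> \<le> \<epsilon>"
    unfolding \<delta>_def by (auto intro: LeastI Least_le)
  have ge: "omega * \<delta> \<le> b"
  proof (rule ccontr)
    assume "\<not> omega * \<delta> \<le> b"
    then obtain d where "d < \<delta>" "?Q d"
      using times_omega1_rec[of omega \<delta> b] by (auto simp: not_le[symmetric])
    then show False
      unfolding \<delta>_def using not_less_Least by blast
  qed
  then obtain d where d: "d < omega" "b \<le> omega * \<delta> + d"
    using Q plus_omega1_rec[of "omega * \<delta>" omega b] by (meson leD leI)
  then have "\<exists>m. b \<le> (succ_ord ^^ m) (omega * \<delta>)"
    using less_omega_iff plus_fin_ord by auto
  then obtain m where "b \<le> (succ_ord ^^ m) (omega * \<delta>)" ..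
  with ge have "\<exists>m. b = (succ_ord ^^ m) (omega * \<delta>)"
  proof (induction m)
    case 0
    then show ?case
      by (intro exI[of _ 0]) simp
  next
    case (Suc m)
    show ?case
    proof (cases "b = (succ_ord ^^ Suc m) (omega * \<delta>)")
      case False
      with Suc.prems(2) have "b < succ_ord ((succ_ord ^^ m) (omega * \<delta>))"
        by simp
      then show ?thesis
        using Suc.IH Suc.prems(1) by (simp add: less_succ_ord_iff)
    qed blast
  qed
  then show ?thesis
    using that order.strict_trans1[OF \<open>\<delta> \<le> \<epsilon>\<close> \<epsilon>(1)] by blast
qed


section \<open>Descending sequences of ordinals\<close>

text \<open>
  Of the descending sequence this keeps the ordinal \<open>b\<close> at which it arrives: what the player can
  still spend.
\<close>

fun descends :: "(omega1 \<Rightarrow> nat \<Rightarrow> omega1) \<Rightarrow> omega1 \<Rightarrow> nat list \<Rightarrow> omega1 \<Rightarrow> bool" where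
  "descends w a [] b \<longleftrightarrow> a = b"
| "descends w a (v # vs) b \<longleftrightarrow> a \<noteq> 0 \<and> descends w (w a v) vs b"

lemma dom_descent_iff: "vs \<in> dom (descent w a) \<longleftrightarrow> (\<exists>b. descends w a vs b)"
  by (induction vs arbitrary: a) (auto simp: domIff)

lemma descends_append:
  "descends w a (us @ vs) b \<longleftrightarrow> (\<exists>c. descends w a us c \<and> descends w c vs b)"
  by (induction us arbitrary: a) auto

lemma descends_functional: "descends w a vs b \<Longrightarrow> descends w a vs c \<Longrightarrow> b = c"
  by (induction vs arbitrary: a) auto

lemma ex_enumerated:
  assumes "is_enumeration w" "b < a"
  shows "\<exists>v. w a v = b \<and> a \<noteq> 0"
proof -
  have "a \<noteq> 0"
    using assms(2) leD zero_le_omega1 by blast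
  moreover from this have "range (w a) = {..<a}"
    using assms(1) by (auto simp: is_enumeration_def zero_less_omega1_iff)
  ultimately show ?thesis
    using assms(2) by (metis imageE lessThan_iff)
qed

text \<open>
  Each entry costs at least one successor step; conversely, by the next lemma, finitely many
  steps of distance can be spent one at a time.
\<close>

lemma descends_imp_le:
  assumes "is_enumeration w" "descends w a vs b"
  shows "(succ_ord ^^ length vs) b \<le> a"
  using assms(2)
proof (induction vs arbitrary: a)
  case (Cons v vs)
  then have "(succ_ord ^^ length vs) b \<le> w a v"
    by simp
  also have "w a v < a"
    using assms(1) Cons.prems unfolding is_enumeration_def descends.simps
    by (metis lessThan_iff rangeI zero_less_omega1_iff)
  finally show ?case
    by (simp add: succ_ord_le_iff)
qed simp

lemma ex_descends:
  assumes "is_enumeration w" "(succ_ord ^^ m) b \<le> a"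
  shows "\<exists>vs c. length vs = m \<and> descends w a vs c \<and> b \<le> c"
  using assms(2)
proof (induction m arbitrary: a)
  case (Suc m)
  then have "(succ_ord ^^ m) b < a"
    by (simp add: succ_ord_le_iff)
  then obtain v where v: "w a v = (succ_ord ^^ m) b" "a \<noteq> 0"
    using ex_enumerated[OF assms(1)] by blast
  obtain vs c where "length vs = m" "descends w (w a v) vs c" "b \<le> c"
    using Suc.IH[of "w a v"] v by auto
  then show ?case
    using v by (intro exI[of _ "v # vs"] exI[of _ c]) simp
qed simp


section \<open>Finite parts of marked words\<close>

lemma initial_segment_iff: "\<sigma> \<sqsubseteq> x \<longleftrightarrow> (\<forall>i<length \<sigma>. x i = \<sigma> ! i)"
proof
  assume *: "\<forall>i<length \<sigma>. x i = \<sigma> ! i"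
  have "x = \<sigma> \<frown> suffix (length \<sigma>) x"
    using * by (auto simp: conc_def)
  then show "\<sigma> \<sqsubseteq> x"
    unfolding initial_segment_def by blast
qed (auto simp: initial_segment_def)

lemma initial_segment_prefix: "prefix l x \<sqsubseteq> x"
  by (simp add: initial_segment_iff subsequence_def)

lemma cylinder_subset:
  assumes "\<sigma> \<sqsubseteq> x" "\<tau> \<sqsubseteq> x" "length \<sigma> \<le> length \<tau>"
  shows "cylinder \<tau> \<subseteq> cylinder \<sigma>"
  using assms by (auto simp: cylinder_def initial_segment_iff)

text \<open>
  Restrictions accumulate over the rounds, but all fixed segments belong to the same sequence, so the
  longest one carries all the information.
\<close>

lemma common_cylinder:
  assumes "\<sigma> \<sqsubseteq> x" "\<tau> \<sqsubseteq> x"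
  obtains \<upsilon> where "\<upsilon> \<sqsubseteq> x" "cylinder \<upsilon> \<subseteq> cylinder \<sigma> \<inter> cylinder \<tau>"
proof (cases "length \<sigma> \<le> length \<tau>")
  case True
  then show ?thesis
    using assms cylinder_subset[of \<sigma> x \<tau>] by (intro that[of \<tau>]) auto
next
  case False
  then show ?thesis
    using assms cylinder_subset[of \<tau> x \<sigma>] by (intro that[of \<sigma>]) auto
qed

definition marked_list :: "(nat list \<times> nat) list \<Rightarrow> nat option list" where
  "marked_list bs = concat (map (\<lambda>(\<theta>, v). map Some \<theta> @ [None, Some v]) bs)"

text \<open>
  The encoded finite part of a marked word with the complete blocks \<open>bs\<close>, followed by a segment \<open>s\<close> without
  marks. Prefixes of this form are cofinal among all prefixes of a marked word, which avoids
  segments that stop between \<open>#\<close> and its argument.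
\<close>

definition encode_list :: "(nat list \<times> nat) list \<Rightarrow> nat list \<Rightarrow> nat list" where
  "encode_list bs s = map (case_option 0 Suc) (marked_list bs @ map Some s)"

lemma marked_append: "marked (bs @ cs) r = marked_list bs \<frown> marked cs r"
  by (induction bs) (auto simp: marked_list_def)

lemma length_encode_list: "length s \<le> length (encode_list bs s)"
  by (simp add: encode_list_def)

lemma encode_list_initial_segment_iff:
  "encode_list bs s \<sqsubseteq> encode cs r \<longleftrightarrow> marked_list bs @ map Some s \<sqsubseteq> marked cs r"
proof -
  have inj: "case_option 0 Suc x = case_option 0 Suc y \<longleftrightarrow> x = y" for x y :: "nat option"
    by (auto split: option.splits)
  show ?thesis
    unfolding initial_segment_iff encode_list_def encode_def by (simp add: inj del: map_append)
qed

lemma encode_list_initial_segment: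
  assumes "s \<sqsubseteq> r"
  shows "encode_list bs s \<sqsubseteq> encode bs r"
proof -
  from assms obtain y where "r = s \<frown> y"
    by (auto simp: initial_segment_def)
  then have "Some \<circ> r = map Some s \<frown> (Some \<circ> y)"
    by (auto simp: conc_def)
  then have "marked bs r = (marked_list bs @ map Some s) \<frown> (Some \<circ> y)"
    using marked_append[of bs "[]" r] by simp
  then show ?thesis
    unfolding encode_list_initial_segment_iff unfolding initial_segment_def by blast
qed

text \<open>
  The unmarked segment \<open>s\<close> may become part of a later block, so more marks can follow it.
\<close>

lemma encode_list_initial_segment_append:
  "encode_list bs s \<sqsubseteq> encode (bs @ (s @ \<theta>, v) # cs) r"
proof -
  have "marked (bs @ (s @ \<theta>, v) # cs) r =
      (marked_list bs @ map Some s) \<frown> (map Some \<theta> @ [None, Some v]) \<frown> marked cs r"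
    by (simp only: marked_append marked.simps conc_conc map_append append_assoc)
  then show ?thesis
    unfolding encode_list_initial_segment_iff unfolding initial_segment_def by blast
qed

text \<open>
  A finite part determines the blocks completed in it and the decoded word up to its own decoded
  length: decoding is continuous. This is what a fixed segment forces on every later move.
\<close>

lemma encode_list_initial_segmentD:
  assumes "encode_list bs s \<sqsubseteq> encode cs r"
  shows "take (length bs) cs = bs \<and>
    concat (map fst bs) @ s \<sqsubseteq> concat (map fst cs) \<frown> r"
  using assms unfolding encode_list_initial_segment_iff
proof (induction bs arbitrary: cs)
  case Nil
  then have at: "marked cs r i = Some (s ! i)" if "i < length s" for i
    using that by (simp add: initial_segment_iff marked_list_def)
  show ?case
  proof (cases cs)
    case Nil
    then show ?thesis
      using at by (simp add: initial_segment_iff)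
  next
    case (Cons b cs')
    obtain \<theta> v where b: "b = (\<theta>, v)"
      by fastforce
    have marked: "marked cs r = (map Some \<theta> @ [None, Some v]) \<frown> marked cs' r"
      by (simp add: Cons b)
    have "marked cs r (length \<theta>) = None"
      unfolding marked by (simp add: conc_def nth_append)
    then have le: "length s \<le> length \<theta>"
      using at[of "length \<theta>"] by (cases "length \<theta> < length s") auto
    have "\<theta> ! i = s ! i" if "i < length s" for i
      using at[OF that] le that unfolding marked by (simp add: conc_def nth_append)
    then show ?thesis
      using le by (simp add: Cons b initial_segment_iff conc_def nth_append)
  qed
next
  case (Cons b bs)
  obtain \<theta> v where b: "b = (\<theta>, v)"
    by fastforce
  from Cons.prems obtain y where
    y: "marked cs r = (map Some \<theta> @ [None, Some v]) \<frown> (marked_list bs @ map Some s) \<frown> y"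
    by (auto simp: initial_segment_def marked_list_def b)
  show ?case
  proof (cases cs)
    case Nil
    have "marked cs r (length \<theta>) = None"
      unfolding y by (simp add: conc_def nth_append)
    then show ?thesis
      by (simp add: Nil)
  next
    case (Cons b' cs')
    obtain \<theta>' v' where b': "b' = (\<theta>', v')"
      by fastforce
    have "\<theta>' = \<theta> \<and> v' = v \<and> marked cs' r = (marked_list bs @ map Some s) \<frown> y"
      by (rule marked_block_inject) (use y in \<open>simp add: Cons b'\<close>)
    moreover from this have "marked_list bs @ map Some s \<sqsubseteq> marked cs' r"
      unfolding initial_segment_def by blast
    then have "take (length bs) cs' = bs \<and>
        concat (map fst bs) @ s \<sqsubseteq> concat (map fst cs') \<frown> r"
      by (rule Cons.IH)
    then obtain z where "take (length bs) cs' = bs"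
        "concat (map fst cs') \<frown> r = (concat (map fst bs) @ s) \<frown> z"
      by (auto simp: initial_segment_def)
    ultimately show ?thesis
      by (auto simp: Cons b b' initial_segment_def conc_conc[symmetric] simp del: conc_conc)
  qed
qed


section \<open>Names of colorings\<close>

fun cut :: "'a word \<Rightarrow> nat \<Rightarrow> nat list \<Rightarrow> 'a list list" where
  "cut x m [] = []"
| "cut x m (h # hs) = (subsequence x m h) # cut x h hs"

lemma length_cut [simp]: "length (cut x m hs) = length hs"
  by (induction hs arbitrary: m) auto

lemma subsequence_join: "l \<le> m \<Longrightarrow> m \<le> h \<Longrightarrow> subsequence x l m @ subsequence x m h = subsequence x l h"
  using upt_add_eq_append[of l m "h - m"] by (simp add: subsequence_def flip: map_append)

lemma concat_take_cut:
  "sorted (m # hs) \<Longrightarrow> i < length hs \<Longrightarrow> concat (take (Suc i) (cut x m hs)) = subsequence x m (hs ! i)"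
proof (induction hs arbitrary: m i)
  case (Cons h hs)
  show ?case
  proof (cases i)
    case (Suc j)
    then have "concat (take (Suc i) (cut x m (h # hs))) = subsequence x m h @ (subsequence x h (hs ! j))"
      using Cons.IH[of h j] Cons.prems by simp
    also have "\<dots> = subsequence x m (hs ! j)"
      using Cons.prems Suc by (intro subsequence_join) auto
    finally show ?thesis
      by (simp add: Suc)
  qed simp
qed simp

lemma sorted_le_last: "sorted xs \<Longrightarrow> x \<in> set xs \<Longrightarrow> x \<le> last xs"
  by (induction xs rule: rev_induct) (auto simp: sorted_append)

lemma concat_cut: "sorted (m # hs) \<Longrightarrow> concat (cut x m hs) = subsequence x m (last (m # hs))"
proof (induction hs arbitrary: m)
  case (Cons h hs)
  have "h \<le> last (h # hs)"
    using Cons.prems by (intro sorted_le_last) auto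
  then have "subsequence x m h @ subsequence x h (last (h # hs)) = subsequence x m (last (h # hs))"
    using Cons.prems by (intro subsequence_join) auto
  then show ?case
    using Cons.IH[of h] Cons.prems by simp
qed (simp add: subsequence_def)

lemma cut_append: "cut x m (hs @ ks) = cut x m hs @ cut x (last (m # hs)) ks"
  by (induction hs arbitrary: m) auto

lemma cut_cong:
  "sorted (m # hs) \<Longrightarrow> \<forall>i<last (m # hs). x i = y i \<Longrightarrow> cut x m hs = cut y m hs"
proof (induction hs arbitrary: m)
  case (Cons h hs)
  have "h \<le> last (h # hs)"
    using Cons.prems(1) by (intro sorted_le_last) auto
  then have "subsequence x m h = subsequence y m h"
    using Cons.prems(2) by (auto simp: subsequence_def)
  then show ?case
    using Cons.IH[of h] Cons.prems by simp
qed simp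

text \<open>
  A color corresponds to the index of its first appearance.
\<close>

lemma bij_betw_new_color_indices:
  fixes c :: "'a word"
  shows "bij_betw c {i. c i \<notin> c ` {..<i}} (range c)"
  unfolding bij_betw_def
proof
  show "inj_on c {i. c i \<notin> c ` {..<i}}"
    by (rule linorder_inj_onI') (metis (mono_tags, lifting) image_eqI lessThan_iff mem_Collect_eq)
  have "c j \<in> c ` {i. c i \<notin> c ` {..<i}}" for j
  proof -
    define i where "i = (LEAST i. c i = c j)"
    have "c i = c j"
      unfolding i_def by (rule LeastI) simp
    moreover have "c i \<notin> c ` {..<i}"
    proof
      assume "c i \<in> c ` {..<i}"
      then obtain l where "l < i" "c l = c j"
        using \<open>c i = c j\<close> by auto
      then show False
        unfolding i_def using not_less_Least by blast
    qed
    ultimately show ?thesis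
      by (metis (mono_tags, lifting) image_eqI mem_Collect_eq)
  qed
  then show "c ` {i. c i \<notin> c ` {..<i}} = range c"
    by auto
qed

definition cut_points :: "nat word \<Rightarrow> nat list" where
  "cut_points c = map Suc (new_color_indices c)"

lemma finite_new_color_indices:
  fixes c :: "'a word"
  shows "finite (range c) \<Longrightarrow> finite {i. c i \<notin> c ` {..<i}}"
  using bij_betw_finite[OF bij_betw_new_color_indices] by blast

lemma length_cut_points: "finite (range c) \<Longrightarrow> length (cut_points c) = card (range c)"
  using bij_betw_same_card[OF bij_betw_new_color_indices[of c]]
  by (simp add: cut_points_def new_color_indices_def)

lemma sorted_cut_points: "sorted (0 # cut_points c)"
  unfolding cut_points_def new_color_indices_def
  by (auto simp: sorted_map intro: sorted_wrt_mono_rel[rotated] sorted_sorted_list_of_set)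

text \<open>
  Changing a coloring only beyond the last first appearance leaves the old first appearances in
  place, and puts the new ones after the change.
\<close>

lemma cut_points_extend:
  fixes c d :: "nat word"
  assumes "finite (range c)" "finite (range d)" and agree: "\<forall>i<l. d i = c i"
    and l: "last (0 # cut_points c) \<le> l"
  obtains hs where "cut_points d = cut_points c @ hs" "\<forall>h\<in>set hs. l < h"
proof -
  let ?N = "\<lambda>c. {i. c i \<notin> c ` {..<i}}"
  have below: "i < l" if "i \<in> ?N c" for i
  proof -
    have "Suc i \<in> set (0 # cut_points c)"
      using that finite_new_color_indices[OF assms(1)]
      by (simp add: cut_points_def new_color_indices_def)
    then have "Suc i \<le> last (0 # cut_points c)"
      by (rule sorted_le_last[OF sorted_cut_points])
    then show ?thesis
      using l by simp
  qed
  have same: "d ` {..<i} = c ` {..<i}" if "i < l" for i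
    using agree that by (intro image_cong) auto
  have N: "?N d = ?N c \<union> {i \<in> ?N d. l \<le> i}"
  proof (rule set_eqI)
    fix i
    show "i \<in> ?N d \<longleftrightarrow> i \<in> ?N c \<union> {i \<in> ?N d. l \<le> i}"
    proof (cases "i < l")
      case True
      then show ?thesis
        using agree same by simp
    next
      case False
      then show ?thesis
        using below by auto
    qed
  qed
  define X Y where "X = ?N c" and "Y = {i \<in> ?N d. l \<le> i}"
  have N': "?N d = X \<union> Y"
    unfolding X_def Y_def by (rule N)
  have fin: "finite X" "finite Y"
    using finite_new_color_indices[OF assms(1)] finite_new_color_indices[OF assms(2)]
    by (simp_all add: X_def Y_def)
  have XY: "x < y" if "x \<in> X" "y \<in> Y" for x y
    using below[of x] that by (simp add: X_def Y_def)
  have "sorted_list_of_set (X \<union> Y) = sorted_list_of_set X @ sorted_list_of_set Y"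
  proof (rule sorted_distinct_set_unique)
    show "sorted (sorted_list_of_set X @ sorted_list_of_set Y)"
      using fin XY by (auto simp: sorted_append less_imp_le)
    show "distinct (sorted_list_of_set X @ sorted_list_of_set Y)"
      using fin XY by auto
  qed (use fin in simp_all)
  then have "cut_points d = cut_points c @ map Suc (sorted_list_of_set Y)"
    using N' by (simp add: cut_points_def new_color_indices_def X_def)
  moreover have "\<forall>h\<in>set (map Suc (sorted_list_of_set Y)). l < h"
    using fin by (auto simp: Y_def)
  ultimately show ?thesis
    by (rule that)
qed

text \<open>
  The blocks of a name are forced by the coloring, as they end at the first appearances; only the
  labels \<open>vs\<close> are free.
\<close>

definition name_of :: "nat word \<Rightarrow> nat list \<Rightarrow> nat word" where
  "name_of c vs = encode (zip (cut c 0 (cut_points c)) vs) (suffix (last (0 # cut_points c)) c)"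

lemma is_name_name_of:
  assumes "finite (range c)" "length vs = card (range c)" "descends w a vs b"
  shows "is_name w a c (name_of c vs)"
proof -
  let ?\<theta> = "cut c 0 (cut_points c)"
  let ?bs = "zip ?\<theta> vs"
  have len: "length ?\<theta> = length vs"
    using assms by (simp add: length_cut_points)
  have "c = concat (map fst ?bs) \<frown> suffix (last (0 # cut_points c)) c"
    using len concat_cut[OF sorted_cut_points, of c c] by (simp add: map_fst_zip prefix_suffix)
  moreover have "concat (map fst (take (Suc i) ?bs)) = prefix (new_color_indices c ! i + 1) c"
    if "i < length ?bs" for i
  proof -
    have "map fst (take (Suc i) ?bs) = take (Suc i) ?\<theta>"
      using len by (simp add: take_map[symmetric])
    moreover have "i < length (cut_points c)"
      using that by simp
    ultimately show ?thesis
      using concat_take_cut[OF sorted_cut_points[of c], of i c] by (simp add: cut_points_def)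
  qed
  moreover have "map snd ?bs \<in> dom (descent w a)"
    using assms(3) len by (auto simp: dom_descent_iff)
  ultimately show ?thesis
    unfolding is_name_def name_of_def using assms len
    by (intro conjI exI[of _ ?bs] exI[of _ "suffix (last (0 # cut_points c)) c"]) auto
qed

text \<open>
  A finite part of a name is compatible with every recoloring far enough out: its blocks survive,
  and the labels of the new colors appear later.
\<close>

lemma name_of_extend:
  assumes "finite (range c)" "length vs = card (range c)" "\<sigma> \<sqsubseteq> name_of c vs"
  shows "\<exists>l. \<forall>d us. finite (range d) \<longrightarrow> (\<forall>i<l. d i = c i) \<longrightarrow>
    length (vs @ us) = card (range d) \<longrightarrow> \<sigma> \<sqsubseteq> name_of d (vs @ us)"
proof (intro exI allI impI)
  let ?m = "last (0 # cut_points c)"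
  let ?l = "?m + length \<sigma>"
  let ?bs = "zip (cut c 0 (cut_points c)) vs"
  let ?s = "subsequence c ?m ?l"
  fix d us
  assume d: "finite (range d)" "\<forall>i<?l. d i = c i" "length (vs @ us) = card (range d)"
  obtain hs where hs: "cut_points d = cut_points c @ hs" "\<forall>h\<in>set hs. ?l < h"
    by (rule cut_points_extend[OF assms(1) d(1,2)]) auto
  have len: "length (cut_points c) = length vs"
    using assms by (simp add: length_cut_points)
  have cut: "cut d 0 (cut_points c) = cut c 0 (cut_points c)"
    using d(2) by (intro cut_cong sorted_cut_points) auto
  have s: "subsequence d ?m ?l = ?s"
    using d(2) by (auto simp: subsequence_def)
  have bs: "zip (cut d 0 (cut_points d)) (vs @ us) = ?bs @ zip (cut d ?m hs) us"
    unfolding hs cut_append cut using len by simp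
  have "encode_list ?bs ?s \<sqsubseteq> name_of d (vs @ us)"
  proof (cases hs)
    case Nil
    have "?s \<sqsubseteq> suffix ?m d"
      unfolding s[symmetric] by (simp add: initial_segment_iff subsequence_def)
    then show ?thesis
      unfolding name_of_def bs using Nil hs by (simp add: encode_list_initial_segment)
  next
    case (Cons h hs')
    have "length hs = length us"
      using d(3) length_cut_points[OF d(1)] len by (simp add: hs(1))
    then obtain u us' where us: "us = u # us'"
      using Cons by (cases us) auto
    have "subsequence d ?m h = ?s @ subsequence d ?l h"
      unfolding s[symmetric] using hs(2) Cons by (intro subsequence_join[symmetric]) auto
    then show ?thesis
      unfolding name_of_def bs using Cons us by (simp add: encode_list_initial_segment_append)
  qed
  moreover have "encode_list ?bs ?s \<sqsubseteq> name_of c vs"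
    unfolding name_of_def
    by (rule encode_list_initial_segment) (simp add: initial_segment_iff subsequence_def)
  then have "cylinder (encode_list ?bs ?s) \<subseteq> cylinder \<sigma>"
    using assms(3) length_encode_list[of ?s ?bs]
    by (intro cylinder_subset) (auto simp: subsequence_def)
  ultimately show "\<sigma> \<sqsubseteq> name_of d (vs @ us)"
    by (auto simp: cylinder_def)
qed

text \<open>
  The first player only ever plays instances with a known lower bound \<open>a\<close> for the remaining ordinal.
  There is nothing to remember for \<open>\<nat>\<close>, where new colors are free.
\<close>

fun instance_with_room ::
    "(omega1 \<Rightarrow> nat \<Rightarrow> omega1) \<Rightarrow> bound \<Rightarrow> nat word \<Rightarrow> nat word \<Rightarrow> omega1 \<Rightarrow> bool" where
  "instance_with_room w (Ord \<alpha>) c p a \<longleftrightarrow> finite (range c) \<and>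
    (\<exists>vs b. length vs = card (range c) \<and> descends w \<alpha> vs b \<and> a \<le> b \<and> p = name_of c vs)"
| "instance_with_room w Naturals c p a \<longleftrightarrow> finite (range c) \<and> p = c"

lemma instance_with_room_is_instance: "instance_with_room w \<alpha> c p a \<Longrightarrow> is_instance w \<alpha> c p"
  by (cases \<alpha>) (auto intro: is_name_name_of)

lemma is_instance_finite: "is_instance w \<alpha> c p \<Longrightarrow> finite (range c)"
  by (cases \<alpha>) (auto simp: is_name_def)

text \<open>
  A constant coloring needs one color, whose label can be chosen to leave exactly \<open>\<beta>\<close>.
\<close>

lemma instance_with_room_constant:
  assumes "is_enumeration w" "ord_less_bound \<beta> \<alpha>"
  shows "\<exists>p. instance_with_room w \<alpha> (\<lambda>_. 0) p \<beta>"
proof (cases \<alpha>)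
  case (Ord a)
  then obtain v where v: "w a v = \<beta>" "a \<noteq> 0"
    using ex_enumerated assms by fastforce
  show ?thesis
    unfolding Ord instance_with_room.simps using v
    by (intro exI[of _ "name_of (\<lambda>_. 0) [v]"] conjI exI[of _ "[v]"] exI[of _ \<beta>]) auto
qed auto

text \<open>
  Sufficiently late recolorings are always possible, at the price of one step of the ordinal for each
  new color.
\<close>

lemma instance_with_room_extend:
  assumes w: "is_enumeration w" and c: "instance_with_room w \<alpha> c p a" and \<sigma>: "\<sigma> \<sqsubseteq> p"
  shows "\<exists>l. \<forall>d b. finite (range d) \<longrightarrow> (\<forall>i<l. d i = c i) \<longrightarrow> card (range c) \<le> card (range d) \<longrightarrow>
    (succ_ord ^^ (card (range d) - card (range c))) b \<le> a \<longrightarrow>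
    (\<exists>q. \<sigma> \<sqsubseteq> q \<and> instance_with_room w \<alpha> d q b)"
proof (cases \<alpha>)
  case (Ord \<alpha>')
  then obtain vs a' where vs: "finite (range c)" "length vs = card (range c)"
      "descends w \<alpha>' vs a'" "a \<le> a'" "p = name_of c vs"
    using c by auto
  obtain l where l: "\<And>d us. finite (range d) \<Longrightarrow> (\<forall>i<l. d i = c i) \<Longrightarrow>
      length (vs @ us) = card (range d) \<Longrightarrow> \<sigma> \<sqsubseteq> name_of d (vs @ us)"
    using name_of_extend[OF vs(1,2)] \<sigma> vs(5) by blast
  show ?thesis
  proof (rule exI[of _ l], intro allI impI)
    fix d :: "nat word" and b
    assume d: "finite (range d)" "\<forall>i<l. d i = c i" "card (range c) \<le> card (range d)"
      and b: "(succ_ord ^^ (card (range d) - card (range c))) b \<le> a"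
    obtain us b' where us: "length us = card (range d) - card (range c)" "descends w a' us b'" "b \<le> b'"
      using ex_descends[OF w] b vs(4) by (meson order_trans)
    then have "length (vs @ us) = card (range d)"
      using d(3) vs(2) by simp
    moreover have "descends w \<alpha>' (vs @ us) b'"
      using vs(3) us(2) descends_append by blast
    ultimately have "instance_with_room w \<alpha> d (name_of d (vs @ us)) b"
      unfolding Ord instance_with_room.simps using d(1) us(3) by blast
    then show "\<exists>q. \<sigma> \<sqsubseteq> q \<and> instance_with_room w \<alpha> d q b"
      using l[OF d(1,2) \<open>length (vs @ us) = _\<close>] by blast
  qed
next
  case Naturals
  then show ?thesis
    using c \<sigma> by (intro exI[of _ "length \<sigma>"]) (auto simp: initial_segment_iff)
qed

text \<open>
  The coloring depends continuously on its name. Thus the second player can freeze finitely many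
  colors by fixing a finite part of the name.
\<close>

lemma is_instance_continuous:
  assumes "is_instance w \<alpha> c p"
  shows "\<exists>\<sigma>. \<sigma> \<sqsubseteq> p \<and> (\<forall>q d. \<sigma> \<sqsubseteq> q \<longrightarrow> is_instance w \<alpha> d q \<longrightarrow> (\<forall>i<l. d i = c i))"
proof (cases \<alpha>)
  case (Ord a)
  then obtain bs r where bs: "c = concat (map fst bs) \<frown> r" "p = encode bs r"
    using assms by (auto simp: is_name_def)
  let ?s = "prefix l r"
  let ?u = "concat (map fst bs) @ ?s"
  have c: "?u \<sqsubseteq> c"
    unfolding bs by (simp add: initial_segment_iff conc_def nth_append subsequence_def)
  show ?thesis
  proof (rule exI[of _ "encode_list bs ?s"], intro conjI allI impI)
    show "encode_list bs ?s \<sqsubseteq> p"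
      unfolding bs by (intro encode_list_initial_segment initial_segment_prefix)
    fix q d i
    assume q: "encode_list bs ?s \<sqsubseteq> q" and "is_instance w \<alpha> d q" and i: "i < l"
    then obtain bs' r' where "d = concat (map fst bs') \<frown> r'" "q = encode bs' r'"
      by (auto simp: Ord is_name_def)
    then have d: "?u \<sqsubseteq> d"
      using q encode_list_initial_segmentD by blast
    have "i < length ?u"
      using i by (simp add: subsequence_def)
    then show "d i = c i"
      using c d unfolding initial_segment_iff by metis
  qed
next
  case Naturals
  then have "p = c" "\<And>d q. is_instance w \<alpha> d q \<Longrightarrow> q = d"
    using assms by auto
  moreover have "\<forall>i<l. d i = c i" if "prefix l c \<sqsubseteq> d" for d
    using that by (simp add: initial_segment_iff subsequence_def)
  ultimately show ?thesis
    using initial_segment_prefix[of c l] by blast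
qed

lemma RT_instance:
  "is_instance w \<alpha> c p \<Longrightarrow> RT code w n \<alpha> \<beta> p = Some {x. is_solution code w n \<beta> c x}"
  using is_instance_unique unfolding RT_def by fastforce

lemma RT_SomeE:
  assumes "RT code w n \<alpha> \<beta> p = Some S"
  obtains c where "is_instance w \<alpha> c p" "S = {x. is_solution code w n \<beta> c x}"
proof -
  obtain c where "is_instance w \<alpha> c p"
    using assms by (auto simp: RT_def split: if_splits)
  then show ?thesis
    using RT_instance assms by (intro that) fastforce+
qed


section \<open>Colors of sets\<close>

lemma colors_on_subset_range: "colors_on code n c A \<subseteq> range c"
  by (auto simp: colors_on_def)

lemma card_colors_on_le:
  "finite (range c) \<Longrightarrow> card (colors_on code n c A) \<le> card (range c)"
  by (intro card_mono colors_on_subset_range)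

lemma colors_on_mono: "A \<subseteq> B \<Longrightarrow> colors_on code n c A \<subseteq> colors_on code n c B"
  unfolding colors_on_def by (intro image_mono nsets_mono)

lemma colors_on_cong:
  assumes "\<forall>i<l. d i = c i" "code ` ([A]\<^bsup>n\<^esup>) \<subseteq> {..<l}"
  shows "colors_on code n d A = colors_on code n c A"
  unfolding colors_on_def using assms by (intro image_cong) auto

lemma support_append: "support \<phi> \<subseteq> support (\<phi> @ \<psi>)"
  by (auto simp: support_def nth_append)

lemma finite_support: "finite (support \<phi>)"
  by (simp add: support_def)

lemma support_subset:
  assumes "\<phi> \<sqsubseteq> (\<lambda>i. of_bool (i \<in> A))"
  shows "support \<phi> \<subseteq> A"
proof
  fix i
  assume i: "i \<in> support \<phi>"
  then have "of_bool (i \<in> A) = \<phi> ! i"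
    using assms unfolding initial_segment_iff support_def by blast
  with i show "i \<in> A"
    by (cases "i \<in> A") (simp_all add: support_def)
qed

text \<open>
  The first player's weapon. The sets with least element in \<open>F\<close> and code at least \<open>l\<close> get the colors
  in \<open>D\<close>, one color for each element of \<open>F\<close>. An infinite \<open>A \<supseteq> F\<close> contains, for each \<open>f \<in> F\<close>,
  infinitely many \<open>n\<close>-sets with least element \<open>f\<close>, because \<open>n - 1 > 0\<close> elements can be chosen
  above \<open>f\<close>; so one of them has a code beyond \<open>l\<close>. The old colors are reused as part of \<open>D\<close>, which
  keeps the number of new colors as low as possible.
\<close>

lemma recoloring:
  assumes n: "2 \<le> n" and code: "bij_betw code ([UNIV]\<^bsup>n\<^esup>) (UNIV :: nat set)"
    and F: "finite (F :: nat set)" and D: "finite D" "card D = card F" "range c \<subseteq> D"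
  obtains d where "\<forall>i<l. d i = c i" "range d = D"
    "\<And>A. infinite A \<Longrightarrow> F \<subseteq> A \<Longrightarrow> colors_on code n d A = D"
proof -
  obtain g where g: "bij_betw g F D"
    using finite_same_card_bij[OF F D(1)] D(2) by auto
  define dec where "dec = inv_into ([UNIV]\<^bsup>n\<^esup>) code"
  define d where "d i = (if i < l \<or> Min (dec i) \<notin> F then c i else g (Min (dec i)))" for i
  have inj: "inj_on code ([UNIV]\<^bsup>n\<^esup>)"
    using code by (rule bij_betw_imp_inj_on)
  have sub: "range d \<subseteq> D"
    using D(3) bij_betwE[OF g] by (auto simp: d_def)
  have hit: "D \<subseteq> colors_on code n d A" if A: "infinite A" "F \<subseteq> A" for A
  proof
    fix y
    assume "y \<in> D"
    then obtain f where f: "f \<in> F" "y = g f"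
      using g by (auto simp: bij_betw_def)
    let ?A = "A - {..f}"
    let ?T = "insert f ` (nsets ?A (n - 1))"
    have T: "X \<in> [A]\<^bsup>n\<^esup> \<and> Min X = f" if X: "X \<in> ?T" for X
    proof -
      from X obtain Y where Y: "X = insert f Y" "Y \<subseteq> ?A" "finite Y" "card Y = n - 1"
        by (auto simp: nsets_def)
      have "f \<notin> Y"
        using Y(2) by auto
      then have "card X = n"
        using Y n by simp
      moreover have "Min X = f"
        using Y by (intro Min_eqI) auto
      ultimately show ?thesis
        using Y f A(2) by (auto simp: nsets_def)
    qed
    have "infinite (nsets ?A (n - 1))"
      using A(1) n by (intro infinite_imp_infinite_nsets) auto
    moreover have "inj_on (insert f) (nsets ?A (n - 1))"
      by (auto simp: inj_on_def nsets_def insert_eq_iff)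
    ultimately have "infinite ?T"
      using finite_image_iff by blast
    moreover have "inj_on code ?T"
      using T nsets_mono[of A UNIV n] by (intro inj_on_subset[OF inj]) blast
    ultimately have "infinite (code ` ?T)"
      using finite_image_iff by blast
    then obtain X where X: "X \<in> ?T" "l \<le> code X"
      unfolding infinite_nat_iff_unbounded_le by blast
    then have XA: "X \<in> [A]\<^bsup>n\<^esup>" "Min X = f"
      using T by auto
    have "dec (code X) = X"
      unfolding dec_def using XA(1) nsets_mono[of A UNIV n] by (intro inv_into_f_f[OF inj]) auto
    then have "d (code X) = y"
      using X(2) XA(2) f by (simp add: d_def)
    then show "y \<in> colors_on code n d A"
      using XA(1) by (auto simp: colors_on_def)
  qed
  have range: "range d = D"
    using sub hit[of UNIV] colors_on_subset_range[of code n d UNIV] by auto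
  show ?thesis
  proof (rule that[OF _ range])
    show "\<forall>i<l. d i = c i"
      by (simp add: d_def)
    show "colors_on code n d A = D" if "infinite A" "F \<subseteq> A" for A
      using hit[OF that] colors_on_subset_range[of code n d A] range by blast
  qed
qed


section \<open>The first player\<close>

text \<open>
  The invariant compares both ordinals for each admissible answer. If its ordinal is
  \<open>b = \<omega> \<cdot> \<delta> + m\<close> and it has \<open>length bs\<close> marks, then forcing it below \<open>\<omega> \<cdot> \<delta>\<close> takes
  \<open>m + length bs + 1\<close> colors altogether, of which \<open>card (range c)\<close> exist already; the first
  player must be able to pay for the rest and keep \<open>\<omega> \<cdot> \<delta>\<close>. After the first round this is automatic,
  since from \<open>\<omega> \<cdot> \<delta>\<close> every finite number of steps above a smaller multiple is affordable. In the first
  round it says that the first player's reserve is at least the starting ordinal of the second.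
  The sets \<open>A\<close> and \<open>B\<close> are what the earlier rounds left of the instances and the solutions.
\<close>

lemma Player1_wins:
  assumes n: "2 \<le> n" and code: "bij_betw code ([UNIV]\<^bsup>n\<^esup>) (UNIV :: nat set)"
    and w: "is_enumeration w"
    and "instance_with_room w \<alpha> c p a" and "\<tau> \<sqsubseteq> p" and "cylinder \<tau> \<subseteq> A"
    and "\<And>bs q b. encode bs q \<in> B \<Longrightarrow> is_solution code w n \<beta> c (encode bs q) \<Longrightarrow>
      descends w \<beta> (map snd bs) b \<Longrightarrow> \<exists>\<delta><\<gamma>. \<exists>m. b = (succ_ord ^^ m) (omega * \<delta>) \<and>
        (succ_ord ^^ (m + length bs + 1 - card (range c))) (omega * \<delta>) \<le> a"
  shows "wins Player1 (Stage1 (restrict_problem (RT code w n \<alpha> \<beta>) A B) \<gamma>)"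
  using assms(4-)
proof (induction \<gamma> arbitrary: c p a \<tau> A B rule: less_induct)
  case (less \<gamma>)
  have "p \<in> A"
    using less.prems(2,3) by (auto simp: cylinder_def)
  then have P: "restrict_problem (RT code w n \<alpha> \<beta>) A B p =
      Some ({x. is_solution code w n \<beta> c x} \<inter> B)"
    using RT_instance[OF instance_with_room_is_instance[OF less.prems(1)]]
    by (simp add: restrict_problem_eq)
  have fin: "finite (range c)"
    using is_instance_finite[OF instance_with_room_is_instance[OF less.prems(1)]] .
  show ?case
  proof (rule wins_Player1I[of "restrict_problem (RT code w n \<alpha> \<beta>) A B", OF P])
    fix x
    assume x: "x \<in> {x. is_solution code w n \<beta> c x} \<inter> B"
    then obtain bs q A0 where bs: "x = encode bs q" "infinite A0"
        "concat (map fst bs) \<frown> q = (\<lambda>i. of_bool (i \<in> A0))" "map snd bs \<in> dom (descent w \<beta>)"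
      by (auto simp: is_solution_def)
    then obtain b where b: "descends w \<beta> (map snd bs) b"
      by (auto simp: dom_descent_iff)
    obtain \<delta> m where \<delta>: "\<delta> < \<gamma>" "b = (succ_ord ^^ m) (omega * \<delta>)"
        "(succ_ord ^^ (m + length bs + 1 - card (range c))) (omega * \<delta>) \<le> a"
      using less.prems(4)[of bs q b] x bs(1) b by auto
    \<comment> \<open>One element for each color, including the old colors that are reused.\<close>
    define M where "M = max (card (range c)) (m + length bs + 1)"
    obtain F where F: "F \<subseteq> A0" "finite F" "card F = M"
      using infinite_arbitrarily_large[OF bs(2)] by blast
    obtain h where h: "F \<subseteq> {..<h}"
      using finite_nat_bounded[OF F(2)] by blast
    let ?s = "prefix h q"
    let ?\<rho> = "encode_list bs ?s"
    have "?\<rho> \<sqsubseteq> x"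
      unfolding bs by (intro encode_list_initial_segment initial_segment_prefix)
    moreover have "\<exists>\<delta><\<gamma>. wins Player1 (Stage1 (restrict_problem
        (restrict_problem (RT code w n \<alpha> \<beta>) A B) (cylinder \<sigma>) (cylinder ?\<rho>)) \<delta>)"
      if \<sigma>: "\<sigma> \<sqsubseteq> p" for \<sigma>
    proof -
      obtain \<upsilon> where \<upsilon>: "\<upsilon> \<sqsubseteq> p" "cylinder \<upsilon> \<subseteq> cylinder \<sigma> \<inter> cylinder \<tau>"
        using common_cylinder[OF \<sigma> less.prems(2)] .
      obtain l where l: "\<And>d b. finite (range d) \<Longrightarrow> \<forall>i<l. d i = c i \<Longrightarrow>
          card (range c) \<le> card (range d) \<Longrightarrow>
          (succ_ord ^^ (card (range d) - card (range c))) b \<le> a \<Longrightarrow>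
          \<exists>q. \<upsilon> \<sqsubseteq> q \<and> instance_with_room w \<alpha> d q b"
        using instance_with_room_extend[OF w less.prems(1) \<upsilon>(1)] by blast
      have inf: "infinite (UNIV - range c)"
        using fin by (simp add: Diff_infinite_finite)
      then obtain E where E: "E \<subseteq> UNIV - range c" "finite E" "card E = M - card (range c)"
        using infinite_arbitrarily_large[OF inf] by blast
      define D where "D = range c \<union> E"
      have cardD: "card D = M"
        unfolding D_def using E fin by (subst card_Un_disjoint) (auto simp: M_def)
      obtain d where d: "\<forall>i<l. d i = c i" "range d = D"
          "\<And>A. infinite A \<Longrightarrow> F \<subseteq> A \<Longrightarrow> colors_on code n d A = D"
        by (rule recoloring[OF n code F(2), of D c l]) (use E fin cardD F(3) in \<open>auto simp: D_def\<close>)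
      have "M - card (range c) = m + length bs + 1 - card (range c)"
        by (simp add: M_def max_def)
      then obtain p' where p': "\<upsilon> \<sqsubseteq> p'" "instance_with_room w \<alpha> d p' (omega * \<delta>)"
        using l[of d "omega * \<delta>"] d(1,2) cardD \<delta>(3) fin E(2) by (auto simp: D_def M_def)
      have "wins Player1 (Stage1
          (restrict_problem (RT code w n \<alpha> \<beta>) (A \<inter> cylinder \<sigma>) (B \<inter> cylinder ?\<rho>)) \<delta>)"
      proof (rule less.IH[OF \<delta>(1) p'(2,1)])
        show "cylinder \<upsilon> \<subseteq> A \<inter> cylinder \<sigma>"
          using \<upsilon>(2) less.prems(3) by auto
        fix bs' q' b'
        assume x': "encode bs' q' \<in> B \<inter> cylinder ?\<rho>"
            "is_solution code w n \<beta> d (encode bs' q')" and b': "descends w \<beta> (map snd bs') b'"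
        from x'(2) obtain A1 where A1: "infinite A1" "card (colors_on code n d A1) \<le> length bs'"
            "concat (map fst bs') \<frown> q' = (\<lambda>i. of_bool (i \<in> A1))"
          by (auto simp: is_solution_def encode_inject)
        have "?\<rho> \<sqsubseteq> encode bs' q'"
          using x'(1) by (simp add: cylinder_def)
        from encode_list_initial_segmentD[OF this]
        have take: "take (length bs) bs' = bs"
          and seg: "concat (map fst bs) @ ?s \<sqsubseteq> (\<lambda>i. of_bool (i \<in> A1))"
          unfolding A1(3) by auto
        have seg0: "concat (map fst bs) @ ?s \<sqsubseteq> (\<lambda>i. of_bool (i \<in> A0))"
          unfolding bs(3)[symmetric]
          by (simp add: initial_segment_iff conc_def nth_append subsequence_def)
        \<comment> \<open>The fixed segment is long enough to decide membership for all elements of \<open>F\<close>.\<close>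
        have "F \<subseteq> A1"
        proof
          fix i
          assume i: "i \<in> F"
          then have "i < length (concat (map fst bs) @ ?s)"
            using h by (auto simp: subsequence_def)
          then have "of_bool (i \<in> A1) = (of_bool (i \<in> A0) :: nat)"
            using seg seg0 unfolding initial_segment_iff by metis
          moreover have "i \<in> A0"
            using i F(1) by blast
          ultimately show "i \<in> A1"
            by (cases "i \<in> A1") simp_all
        qed
        then have "M \<le> length bs'"
          using A1(1,2) d(3) cardD by auto
        then have len: "Suc m \<le> length bs' - length bs"
          unfolding M_def by linarith
        define cs where "cs = drop (length bs) bs'"
        have "bs' = bs @ cs"
          using take append_take_drop_id[of "length bs" bs'] by (simp add: cs_def)
        then have "descends w b (map snd cs) b'"
          using b' descends_functional[OF b] by (auto simp: descends_append)
        then have "(succ_ord ^^ length cs) b' \<le> b"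
          using descends_imp_le[OF w] by fastforce
        then have *: "(succ_ord ^^ Suc m) b' \<le> (succ_ord ^^ m) (omega * \<delta>)"
          using funpow_succ_ord_le[of "Suc m" "length cs" b'] len \<delta>(2)
          by (simp add: cs_def del: funpow.simps)
        \<comment> \<open>More than \<open>m\<close> further marks cannot fit between \<open>\<omega> \<cdot> \<delta>\<close> and \<open>\<omega> \<cdot> \<delta> + m\<close>.\<close>
        have "b' < omega * \<delta>"
        proof (rule ccontr)
          assume "\<not> b' < omega * \<delta>"
          then have "(succ_ord ^^ m) (omega * \<delta>) \<le> (succ_ord ^^ m) b'"
            by (intro funpow_succ_ord_mono) simp
          with * show False
            by (simp add: succ_ord_le_iff)
        qed
        then obtain \<epsilon> m' where \<epsilon>: "\<epsilon> < \<delta>" "b' = (succ_ord ^^ m') (omega * \<epsilon>)"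
          by (rule less_omega_multE)
        then show "\<exists>\<epsilon><\<delta>. \<exists>m. b' = (succ_ord ^^ m) (omega * \<epsilon>) \<and>
            (succ_ord ^^ (m + length bs' + 1 - card (range d))) (omega * \<epsilon>) \<le> omega * \<delta>"
          using omega_mult_less less_imp_le by blast
      qed
      then show ?thesis
        unfolding restrict_problem_restrict_problem using \<delta>(1) by blast
    qed
    ultimately show "\<exists>\<rho>. \<rho> \<sqsubseteq> x \<and> (\<forall>\<sigma>. \<sigma> \<sqsubseteq> p \<longrightarrow> (\<exists>\<delta><\<gamma>. wins Player1 (Stage1
        (restrict_problem (restrict_problem (RT code w n \<alpha> \<beta>) A B) (cylinder \<sigma>) (cylinder \<rho>)) \<delta>)))"
      by blast
  qed
qed

text \<open>
  The constant coloring with reserve \<open>\<beta>\<close> starts the invariant: an answer with \<open>j\<close> marks has \<open>j \<ge> 1\<close>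
  and an ordinal at least \<open>j\<close> steps below \<open>\<beta>\<close>, and exactly these \<open>j\<close> steps are what the first
  player needs in addition to \<open>m\<close>, one color being there already.
\<close>

lemma Player1_wins_RT:
  assumes n: "2 \<le> n" and code: "bij_betw code ([UNIV]\<^bsup>n\<^esup>) (UNIV :: nat set)"
    and w: "is_enumeration w" and \<beta>: "ord_less_bound \<beta> \<alpha>" "\<beta> \<le> omega * \<gamma>"
  shows "wins Player1 (Stage1 (RT code w n \<alpha> \<beta>) \<gamma>)"
proof -
  obtain p where p: "instance_with_room w \<alpha> (\<lambda>_. 0) p \<beta>"
    using instance_with_room_constant[OF w \<beta>(1)] ..
  have "wins Player1 (Stage1 (restrict_problem (RT code w n \<alpha> \<beta>) UNIV UNIV) \<gamma>)"
  proof (rule Player1_wins[OF n code w p])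
    show "[] \<sqsubseteq> p"
      by (simp add: initial_segment_iff)
    fix bs q b
    assume "is_solution code w n \<beta> (\<lambda>_. 0) (encode bs q)" and b: "descends w \<beta> (map snd bs) b"
    then obtain A where A: "infinite A" "card (colors_on code n (\<lambda>_. 0) A) \<le> length bs"
      by (auto simp: is_solution_def encode_inject)
    have "[A]\<^bsup>n\<^esup> \<noteq> {}"
      using A(1) by (simp add: nsets_eq_empty_iff)
    then have "colors_on code n (\<lambda>_. 0) A = {0}"
      by (auto simp: colors_on_def)
    then obtain k where k: "length bs = Suc k"
      using A(2) by (cases "length bs") auto
    have le: "(succ_ord ^^ length bs) b \<le> \<beta>"
      using descends_imp_le[OF w b] by simp
    moreover have "b < (succ_ord ^^ length bs) b"
      using funpow_succ_ord_le[of 0 k b] by (simp add: k less_succ_ord_iff)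
    ultimately have "b < omega * \<gamma>"
      using \<beta>(2) by auto
    then obtain \<delta> m where "\<delta> < \<gamma>" "b = (succ_ord ^^ m) (omega * \<delta>)"
      by (rule less_omega_multE)
    moreover from this have "(succ_ord ^^ (m + length bs)) (omega * \<delta>) \<le> \<beta>"
      using le by (simp add: add.commute[of m] funpow_add)
    ultimately show "\<exists>\<delta><\<gamma>. \<exists>m. b = (succ_ord ^^ m) (omega * \<delta>) \<and>
        (succ_ord ^^ (m + length bs + 1 - card (range (\<lambda>_::nat. 0::nat)))) (omega * \<delta>) \<le> \<beta>"
      by auto
  qed auto
  then show ?thesis
    by (simp add: restrict_problem_UNIV)
qed


section \<open>The second player\<close>

text \<open>
  An answer from which the second player survives the current rank: it is legal, it leaves at least the
  critical ordinal, and it is an inner point of the set \<open>B\<close> of admissible solutions.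
\<close>

definition good_reply ::
    "(nat set \<Rightarrow> nat) \<Rightarrow> (omega1 \<Rightarrow> nat \<Rightarrow> omega1) \<Rightarrow> nat \<Rightarrow> omega1 \<Rightarrow> omega1 \<Rightarrow>
      nat word set \<Rightarrow> nat word \<Rightarrow> nat word \<Rightarrow> bool" where
  "good_reply code w n \<beta> \<gamma> B c x \<longleftrightarrow> is_solution code w n \<beta> c x \<and>
    (\<exists>bs q b. x = encode bs q \<and> descends w \<beta> (map snd bs) b \<and> omega * \<gamma> \<le> b) \<and>
    (\<exists>\<tau>. \<tau> \<sqsubseteq> x \<and> cylinder \<tau> \<subseteq> B)"

text \<open>
  The situation of the second player between rounds, described by a finite part of the last answer,
  with complete blocks \<open>bs\<close> and a further unmarked segment \<open>s\<close>. The set \<open>H\<close> only serves to say that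
  the decoded part is a string of zeros and ones. The colors of this part obey the bounds in every
  instance that is still admissible, and any finite number of marks is affordable at rank \<open>\<gamma>\<close>.
\<close>

definition safe ::
    "(nat set \<Rightarrow> nat) \<Rightarrow> (omega1 \<Rightarrow> nat \<Rightarrow> omega1) \<Rightarrow> nat \<Rightarrow> bound \<Rightarrow> omega1 \<Rightarrow> omega1 \<Rightarrow>
      nat word set \<Rightarrow> nat word set \<Rightarrow> bool" where
  "safe code w n \<alpha> \<beta> \<gamma> A B \<longleftrightarrow> (\<exists>bs s b H.
    cylinder (encode_list bs s) \<subseteq> B \<and> descends w \<beta> (map snd bs) b \<and>
    (\<forall>m. (succ_ord ^^ m) (omega * \<gamma>) \<le> b) \<and>
    concat (map fst bs) @ s \<sqsubseteq> (\<lambda>i. of_bool (i \<in> H)) \<and>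
    (\<forall>p c. p \<in> A \<longrightarrow> is_instance w \<alpha> c p \<longrightarrow>
      (\<forall>i\<le>length bs. card (colors_on code n c (support (concat (map fst (take i bs))))) \<le> i) \<and>
      card (colors_on code n c (support (concat (map fst bs) @ s))) \<le> length bs))"

text \<open>
  The part of the answer that matters is finite, so finitely many values of the coloring decide all
  its colors, and the second player fixes these values. The gain in room comes from
  \<open>\<omega> \<cdot> \<delta> + m < \<omega> \<cdot> \<gamma>\<close> for all \<open>m\<close>.
\<close>

lemma good_reply_imp_safe:
  assumes c: "is_instance w \<alpha> c p" and x: "good_reply code w n \<beta> \<gamma> B c x" and \<rho>: "\<rho> \<sqsubseteq> x"
  shows "\<exists>\<sigma>. \<sigma> \<sqsubseteq> p \<and> (\<forall>\<delta><\<gamma>. safe code w n \<alpha> \<beta> \<delta> (A \<inter> cylinder \<sigma>) (B \<inter> cylinder \<rho>))"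
proof -
  obtain bs q b where bs: "x = encode bs q" "descends w \<beta> (map snd bs) b" "omega * \<gamma> \<le> b"
    using x by (auto simp: good_reply_def)
  obtain \<tau> where \<tau>: "\<tau> \<sqsubseteq> x" "cylinder \<tau> \<subseteq> B"
    using x by (auto simp: good_reply_def)
  have "is_solution code w n \<beta> c (encode bs q)"
    using x bs(1) by (simp add: good_reply_def)
  then obtain H where H: "concat (map fst bs) \<frown> q = (\<lambda>i. of_bool (i \<in> H))"
      "card (colors_on code n c H) \<le> length bs"
      "\<forall>i\<le>length bs. card (colors_on code n c (support (concat (map fst (take i bs))))) \<le> i"
    by (auto simp: is_solution_def encode_inject)
  obtain \<upsilon> where \<upsilon>: "\<upsilon> \<sqsubseteq> x" "cylinder \<upsilon> \<subseteq> cylinder \<rho> \<inter> cylinder \<tau>"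
    using common_cylinder[OF \<rho> \<tau>(1)] .
  define s where "s = prefix (length \<upsilon>) q"
  have "encode_list bs s \<sqsubseteq> x"
    unfolding bs s_def by (intro encode_list_initial_segment initial_segment_prefix)
  then have "cylinder (encode_list bs s) \<subseteq> cylinder \<upsilon>"
    using length_encode_list[of s bs]
    by (intro cylinder_subset[OF \<upsilon>(1)]) (auto simp: s_def subsequence_def)
  then have cyl: "cylinder (encode_list bs s) \<subseteq> B \<inter> cylinder \<rho>"
    using \<upsilon>(2) \<tau>(2) by auto
  have seg: "concat (map fst bs) @ s \<sqsubseteq> (\<lambda>i. of_bool (i \<in> H))"
    unfolding H(1)[symmetric] s_def
    by (simp add: initial_segment_iff conc_def nth_append subsequence_def)
  let ?G = "support (concat (map fst bs) @ s)"
  have "finite (code ` ([?G]\<^bsup>n\<^esup>))"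
    by (intro finite_imageI finite_imp_finite_nsets finite_support)
  then obtain l where l: "code ` ([?G]\<^bsup>n\<^esup>) \<subseteq> {..<l}"
    using finite_nat_bounded by blast
  obtain \<sigma> where \<sigma>: "\<sigma> \<sqsubseteq> p"
      "\<And>p' d. \<sigma> \<sqsubseteq> p' \<Longrightarrow> is_instance w \<alpha> d p' \<Longrightarrow> \<forall>i<l. d i = c i"
    using is_instance_continuous[OF c, of l] by blast
  have "safe code w n \<alpha> \<beta> \<delta> (A \<inter> cylinder \<sigma>) (B \<inter> cylinder \<rho>)" if \<delta>: "\<delta> < \<gamma>" for \<delta>
    unfolding safe_def
  proof (intro exI conjI allI impI)
    show "cylinder (encode_list bs s) \<subseteq> B \<inter> cylinder \<rho>" by (rule cyl)
    show "descends w \<beta> (map snd bs) b" by (rule bs(2))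
    show "(succ_ord ^^ m) (omega * \<delta>) \<le> b" for m
      using omega_mult_less[OF \<delta>, of m] bs(3) by simp
    show "concat (map fst bs) @ s \<sqsubseteq> (\<lambda>i. of_bool (i \<in> H))" by (rule seg)
    fix p' d
    assume "p' \<in> A \<inter> cylinder \<sigma>" "is_instance w \<alpha> d p'"
    then have agree: "\<forall>i<l. d i = c i"
      using \<sigma>(2) by (auto simp: cylinder_def)
    have same: "colors_on code n d X = colors_on code n c X" if "X \<subseteq> ?G" for X
      using l nsets_mono[OF that, of n] by (intro colors_on_cong[OF agree]) auto
    have "card (colors_on code n c ?G) \<le> card (colors_on code n c H)"
      using finite_subset[OF colors_on_subset_range is_instance_finite[OF c]]
      by (intro card_mono colors_on_mono support_subset[OF seg]) auto
    then show "card (colors_on code n d ?G) \<le> length bs"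
      using same[of ?G] H(2) by simp
    fix i
    assume i: "i \<le> length bs"
    have "concat (map fst bs) @ s =
        concat (map fst (take i bs)) @ concat (map fst (drop i bs)) @ s"
      by (metis append.assoc append_take_drop_id concat_append map_append)
    then have "support (concat (map fst (take i bs))) \<subseteq> ?G"
      using support_append by metis
    then show "card (colors_on code n d (support (concat (map fst (take i bs))))) \<le> i"
      using same H(3) i by simp
  qed
  then show ?thesis
    using \<sigma>(1) by blast
qed

text \<open>
  With one additional mark for each color of the new instance, the bound on the number of colors of
  the final set becomes vacuous, and all larger numbers can be added to the part already fixed. The new
  marks come directly after that part, where its color bound already holds.
\<close>

lemma safe_imp_good_reply:
  assumes w: "is_enumeration w" and safe: "safe code w n \<alpha> \<beta> \<gamma> A B"
    and p: "p \<in> A" "is_instance w \<alpha> c p"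
  shows "\<exists>x. good_reply code w n \<beta> \<gamma> B c x"
proof -
  obtain bs s b H where cyl: "cylinder (encode_list bs s) \<subseteq> B"
      and b: "descends w \<beta> (map snd bs) b" "\<And>m. (succ_ord ^^ m) (omega * \<gamma>) \<le> b"
      and seg: "concat (map fst bs) @ s \<sqsubseteq> (\<lambda>i. of_bool (i \<in> H))"
      and part: "\<And>i. i \<le> length bs \<Longrightarrow>
        card (colors_on code n c (support (concat (map fst (take i bs))))) \<le> i"
      and full: "card (colors_on code n c (support (concat (map fst bs) @ s))) \<le> length bs"
    using safe p unfolding safe_def by blast
  have fin: "finite (range c)"
    using p(2) by (rule is_instance_finite)
  obtain vs b' where vs: "length vs = card (range c)" "descends w b vs b'" "omega * \<gamma> \<le> b'"
    using ex_descends[OF w b(2)] by blast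
  moreover have "card (range c) \<noteq> 0"
    using fin by simp
  ultimately obtain v us where v: "vs = v # us"
    by (cases vs) auto
  define \<phi> where "\<phi> = concat (map fst bs) @ s"
  define cs where "cs = bs @ (s, v) # map (Pair []) us"
  define q where "q = (\<lambda>_::nat. 1::nat)"
  define K where "K = {i. (\<phi> \<frown> q) i = 1}"
  have empty: "concat (map fst (map (Pair []) us)) = []" for us :: "nat list"
    by (simp add: comp_def)
  have concat: "concat (map fst cs) = \<phi>"
    using empty[of us] by (simp add: cs_def \<phi>_def)
  have snd: "map snd cs = map snd bs @ vs"
    by (simp add: cs_def v comp_def)
  \<comment> \<open>Characteristic, because the fixed part is an initial segment of the characteristic sequence of \<open>H\<close>.\<close>
  have K: "\<phi> \<frown> q = (\<lambda>i. of_bool (i \<in> K))"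
  proof
    fix i
    have "(\<phi> \<frown> q) i \<in> {0, 1}"
      using seg by (auto simp: conc_def q_def initial_segment_iff \<phi>_def[symmetric])
        (metis of_bool_eq(1,2) One_nat_def)
    then show "(\<phi> \<frown> q) i = of_bool (i \<in> K)"
      by (auto simp: K_def)
  qed
  have "{length \<phi>..} \<subseteq> K"
    by (auto simp: K_def q_def conc_def)
  then have "infinite K"
    using infinite_Ici infinite_super by blast
  moreover have "length cs = length bs + card (range c)"
    using vs(1) by (simp add: cs_def v)
  then have "card (colors_on code n c K) \<le> length cs"
    using card_colors_on_le[OF fin, of code n K] by simp
  moreover have desc: "descends w \<beta> (map snd cs) b'"
    unfolding snd using b(1) vs(2) by (auto simp: descends_append)
  moreover have "card (colors_on code n c (support (concat (map fst (take i cs))))) \<le> i"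
    if "i \<le> length cs" for i
  proof (cases "i \<le> length bs")
    case True
    then show ?thesis
      using part by (simp add: cs_def)
  next
    case False
    then have "take i cs = bs @ (s, v) # map (Pair []) (take (i - length bs - 1) us)"
      by (simp add: cs_def take_Cons' take_map)
    then have "concat (map fst (take i cs)) = \<phi>"
      using empty[of "take (i - length bs - 1) us"] by (simp add: \<phi>_def)
    then show ?thesis
      using full False by (simp add: \<phi>_def)
  qed
  ultimately have "is_solution code w n \<beta> c (encode cs q)"
    unfolding is_solution_def using K concat
    by (intro exI[of _ cs] exI[of _ q] exI[of _ K]) (auto simp: dom_descent_iff)
  moreover have "encode_list bs s \<sqsubseteq> encode cs q"
    using encode_list_initial_segment_append[of bs s "[]" v] by (simp add: cs_def)
  ultimately have "good_reply code w n \<beta> \<gamma> B c (encode cs q)"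
    unfolding good_reply_def using cyl desc vs(3) by blast
  then show ?thesis
    by blast
qed

text \<open>
  If \<open>\<beta>\<close> is the successor of \<open>\<omega> \<cdot> \<gamma>\<close>, a single mark is all the second player can afford while
  staying at the critical value, hence a set with one color is needed. The mark is placed at the very
  beginning, before any element.
\<close>

lemma ex_good_first_reply:
  assumes n: "2 \<le> n" and w: "is_enumeration w" and \<beta>: "omega * \<gamma> < \<beta>"
    and c: "is_instance w \<alpha> c p"
  shows "\<exists>x. good_reply code w n \<beta> \<gamma> UNIV c x"
proof -
  obtain m where m: "range c \<subseteq> {..<m}"
    using finite_nat_bounded[OF is_instance_finite[OF c]] by blast
  obtain H t where H: "infinite H" "\<forall>X. X \<subseteq> H \<and> finite X \<and> card X = n \<longrightarrow> c (code X) = t"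
    using Ramsey[of "UNIV :: nat set" n "\<lambda>X. c (code X)" m] m by (auto simp: image_subset_iff)
  obtain v where v: "w \<beta> v = omega * \<gamma>" "\<beta> \<noteq> 0"
    using ex_enumerated[OF w \<beta>] by blast
  let ?bs = "[([], v)] :: (nat list \<times> nat) list"
  let ?q = "\<lambda>i. of_bool (i \<in> H) :: nat"
  have "colors_on code n c H \<subseteq> {t}"
    using H(2) by (auto simp: colors_on_def nsets_def)
  then have "card (colors_on code n c H) \<le> 1"
    using card_mono[of "{t}"] by force
  moreover have "colors_on code n c (support []) = {}"
    using n by (simp add: colors_on_def support_def nsets_empty_iff)
  then have "card (colors_on code n c (support (concat (map fst (take i ?bs))))) \<le> i" for i
    by (cases i) auto
  moreover have desc: "descends w \<beta> (map snd ?bs) (omega * \<gamma>)"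
    using v by simp
  ultimately have "is_solution code w n \<beta> c (encode ?bs ?q)"
    unfolding is_solution_def using H(1) dom_descent_iff
    by (intro exI[of _ ?bs] exI[of _ ?q] exI[of _ H]) fastforce
  moreover have "[] \<sqsubseteq> encode ?bs ?q"
    by (simp add: initial_segment_iff)
  ultimately have "good_reply code w n \<beta> \<gamma> UNIV c (encode ?bs ?q)"
    unfolding good_reply_def using desc by (metis order_refl subset_UNIV)
  then show ?thesis
    by blast
qed

lemma Player2_wins:
  assumes w: "is_enumeration w"
    and "\<And>p c. p \<in> A \<Longrightarrow> is_instance w \<alpha> c p \<Longrightarrow> \<exists>x. good_reply code w n \<beta> \<gamma> B c x"
  shows "wins Player2 (Stage1 (restrict_problem (RT code w n \<alpha> \<beta>) A B) \<gamma>)"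
  using assms(2)
proof (induction \<gamma> arbitrary: A B rule: less_induct)
  case (less \<gamma>)
  show ?case
  proof (rule wins_Player2I)
    fix p S
    assume "restrict_problem (RT code w n \<alpha> \<beta>) A B p = Some S"
    then obtain T where p: "p \<in> A" and T: "RT code w n \<alpha> \<beta> p = Some T" and S: "S = T \<inter> B"
      by (auto simp: restrict_problem_eq split: if_splits)
    obtain c where c: "is_instance w \<alpha> c p" "T = {x. is_solution code w n \<beta> c x}"
      using T by (rule RT_SomeE)
    obtain x where x: "good_reply code w n \<beta> \<gamma> B c x"
      using less.prems[OF p c(1)] ..
    have "x \<in> S"
      using x by (auto simp: good_reply_def S c(2) cylinder_def)
    moreover have "\<exists>\<sigma>. \<sigma> \<sqsubseteq> p \<and> (\<forall>\<delta><\<gamma>. wins Player2 (Stage1 (restrict_problem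
        (restrict_problem (RT code w n \<alpha> \<beta>) A B) (cylinder \<sigma>) (cylinder \<rho>)) \<delta>))"
      if \<rho>: "\<rho> \<sqsubseteq> x" for \<rho>
    proof -
      obtain \<sigma> where \<sigma>: "\<sigma> \<sqsubseteq> p"
          "\<And>\<delta>. \<delta> < \<gamma> \<Longrightarrow> safe code w n \<alpha> \<beta> \<delta> (A \<inter> cylinder \<sigma>) (B \<inter> cylinder \<rho>)"
        using good_reply_imp_safe[OF c(1) x \<rho>] by blast
      have "wins Player2 (Stage1
          (restrict_problem (RT code w n \<alpha> \<beta>) (A \<inter> cylinder \<sigma>) (B \<inter> cylinder \<rho>)) \<delta>)"
        if "\<delta> < \<gamma>" for \<delta>
        using that safe_imp_good_reply[OF w \<sigma>(2)[OF that]] by (rule less.IH)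
      then show ?thesis
        unfolding restrict_problem_restrict_problem using \<sigma>(1) by blast
    qed
    ultimately show "\<exists>q\<in>S. \<forall>\<rho>. \<rho> \<sqsubseteq> q \<longrightarrow> (\<exists>\<sigma>. \<sigma> \<sqsubseteq> p \<and> (\<forall>\<delta><\<gamma>. wins Player2 (Stage1
        (restrict_problem (restrict_problem (RT code w n \<alpha> \<beta>) A B) (cylinder \<sigma>) (cylinder \<rho>)) \<delta>)))"
      by blast
  qed
qed


section \<open>The winner of the discontinuity game\<close>

theorem theorem5p2p3:
  fixes n :: nat and \<alpha> :: bound and \<beta> \<gamma> :: omega1
    and code :: "nat set \<Rightarrow> nat" and w :: "omega1 \<Rightarrow> nat \<Rightarrow> omega1"
  assumes "n \<ge> 2"
    and "bij_betw code ([UNIV]\<^bsup>n\<^esup>) UNIV"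
    and "is_enumeration w"
    and "ord_less_bound \<beta> \<alpha>"
  shows "(omega * \<gamma> \<ge> \<beta> \<longrightarrow>
           has_winning_strategy Player1 (discontinuity_game \<gamma> (RT code w n \<alpha> \<beta>))) \<and>
         (omega * \<gamma> < \<beta> \<longrightarrow>
           has_winning_strategy Player2 (discontinuity_game \<gamma> (RT code w n \<alpha> \<beta>)))"
  unfolding discontinuity_game_def
proof (intro conjI impI wins_imp_has_winning_strategy)
  assume "\<beta> \<le> omega * \<gamma>"
  then show "wins Player1 (Stage1 (RT code w n \<alpha> \<beta>) \<gamma>)"
    using assms by (intro Player1_wins_RT)
next
  assume "omega * \<gamma> < \<beta>"
  then have "wins Player2 (Stage1 (restrict_problem (RT code w n \<alpha> \<beta>) UNIV UNIV) \<gamma>)"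
    using ex_good_first_reply[OF assms(1,3)] by (intro Player2_wins[OF assms(3)]) blast
  then show "wins Player2 (Stage1 (RT code w n \<alpha> \<beta>) \<gamma>)"
    by (simp add: restrict_problem_UNIV)
qed

end
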